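(* Let $\mathfrak u$ be a compact semisimple real Lie algebra. Then the real Lie algebra $\mathfrak l(\mathfrak u,\pi)$ admits an inner product with negative Ricci curvature for infinitely many (pairwise inequivalent) finite-dimensional irreducible complex representations $(\pi,V)$ of $\mathfrak u_{\mathbb C}=\mathfrak u\otimes_{\mathbb R}\mathbb C$.
   Context: All Lie algebras and representations are finite-dimensional. A real Lie algebra is compact semisimple if its Killing form is negative definite. A complex representation $\pi:\mathfrak u_{\mathbb C}\to\mathfrak{gl}(V)$ is regarded as a real representation of $\mathfrak u$ by restricting $\pi$ to $\mathfrak u$ and regarding $V$ as a real vector space. For a real representation $(\pi,V)$ of $\mathfrak u$, $\mathfrak l(\mathfrak u,\pi):=(\mathbb R Z\oplus\mathfrak u)\ltimes V$ is the real Lie algebra with brackets extending that of $\mathfrak u$ and $[Z,X]=0$, $[Z,v]=v$, $[X,v]=\pi(X)v$, $[v,w]=0$ for all $X\in\mathfrak u$, $v,w\in V$. An inner product on a real Lie algebra $\mathfrak g$ has negative Ricci curvature if the corresponding left-invariant Riemannian metric on the simply connected Lie group with Lie algebra $\mathfrak g$ has negative definite Ricci operator. *)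

theory Defs
  imports "HOL-Analysis.Analysis" "HOL-Library.Function_Algebras"
begin

section \<open>Linear maps between subspaces\<close>

definition linear_on ::
  "('k \<Rightarrow> 'a \<Rightarrow> 'a) \<Rightarrow> ('k \<Rightarrow> 'b \<Rightarrow> 'b) \<Rightarrow> 'a set \<Rightarrow> 'b set \<Rightarrow> ('a::plus \<Rightarrow> 'b::plus) \<Rightarrow> bool"
  where "linear_on s t S T f \<longleftrightarrow>
    f \<in> S \<rightarrow> T \<and>
    (\<forall>x\<in>S. \<forall>y\<in>S. f (x + y) = f x + f y) \<and>
    (\<forall>c. \<forall>x\<in>S. f (s c x) = t c (f x))"

abbreviation real_linear_on ::
  "'a::real_vector set \<Rightarrow> 'b::real_vector set \<Rightarrow> ('a \<Rightarrow> 'b) \<Rightarrow> bool"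
  where "real_linear_on \<equiv> linear_on scaleR scaleR"

definition real_bilinear_on ::
  "'a::real_vector set \<Rightarrow> 'b::real_vector set \<Rightarrow> 'c::real_vector set \<Rightarrow> ('a \<Rightarrow> 'b \<Rightarrow> 'c) \<Rightarrow> bool"
  where "real_bilinear_on S T U f \<longleftrightarrow>
    (\<forall>x\<in>S. real_linear_on T U (f x)) \<and> (\<forall>y\<in>T. real_linear_on S U (\<lambda>x. f x y))"

text \<open>Trace of an endomorphism of the finite-dimensional subspace \<open>S\<close>; the value does not
  depend on the chosen basis.\<close>

definition trace_on :: "'a::real_vector set \<Rightarrow> ('a \<Rightarrow> 'a) \<Rightarrow> real"
  where "trace_on S f =
    (let B = (SOME B. independent B \<and> span B = S) in \<Sum>b\<in>B. representation B (f b) b)"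


section \<open>Real Lie algebras and left-invariant metrics\<close>

locale real_lie_algebra =
  fixes g :: "'a::real_vector set" and br :: "'a \<Rightarrow> 'a \<Rightarrow> 'a"
  assumes finite_dimensional: "\<exists>B. finite B \<and> span B = g"
    and bilinear: "real_bilinear_on g g g br"
    and alternating: "X \<in> g \<Longrightarrow> br X X = 0"
    and jacobi: "X \<in> g \<Longrightarrow> Y \<in> g \<Longrightarrow> Z \<in> g \<Longrightarrow>
      br X (br Y Z) + br Y (br Z X) + br Z (br X Y) = 0"
begin

definition killing_form :: "'a \<Rightarrow> 'a \<Rightarrow> real"
  where "killing_form X Y = trace_on g (\<lambda>Z. br X (br Y Z))"

definition compact_semisimple :: bool
  where "compact_semisimple \<longleftrightarrow> (\<forall>X\<in>g. X \<noteq> 0 \<longrightarrow> killing_form X X < 0)"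

end

locale metric_lie_algebra = real_lie_algebra +
  fixes ip :: "'a \<Rightarrow> 'a \<Rightarrow> real"
  assumes ip_bilinear: "real_bilinear_on g g UNIV ip"
    and ip_symmetric: "X \<in> g \<Longrightarrow> Y \<in> g \<Longrightarrow> ip X Y = ip Y X"
    and ip_positive: "X \<in> g \<Longrightarrow> X \<noteq> 0 \<Longrightarrow> ip X X > 0"
begin

text \<open>
  Elements of \<open>g\<close> are the left-invariant vector fields on the simply connected Lie group of \<open>g\<close>.
  Since the metric is left-invariant, its Levi-Civita connection (and curvature) restricts to them.
  In the compatibility condition \<open>X\<langle>Y, Z\<rangle> = \<langle>D X Y, Z\<rangle> + \<langle>Y, D X Z\<rangle>\<close> the left-hand side vanishes
  because \<open>\<langle>Y, Z\<rangle>\<close> is a constant function on the group.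
\<close>

definition levi_civita :: "('a \<Rightarrow> 'a \<Rightarrow> 'a) \<Rightarrow> bool"
  where "levi_civita D \<longleftrightarrow>
    real_bilinear_on g g g D \<and>
    (\<forall>X\<in>g. \<forall>Y\<in>g. D X Y - D Y X = br X Y) \<and>
    (\<forall>X\<in>g. \<forall>Y\<in>g. \<forall>Z\<in>g. ip (D X Y) Z + ip Y (D X Z) = 0)"

lemma levi_civita_unique:
  assumes D: "levi_civita D" and D': "levi_civita D'" and X: "X \<in> g" and Y: "Y \<in> g"
  shows "D X Y = D' X Y"
proof -
  have sub: "subspace g"
    using finite_dimensional by (metis subspace_span)
  have cl: "D P Q \<in> g" "D' P Q \<in> g" if "P \<in> g" "Q \<in> g" for P Q
    using D D' that by (auto simp: levi_civita_def real_bilinear_on_def linear_on_def Pi_iff)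
  define S where "S P Q = D P Q - D' P Q" for P Q
  have S_cl: "S P Q \<in> g" if "P \<in> g" "Q \<in> g" for P Q
    unfolding S_def using cl that sub by (simp add: subspace_diff)
  have S_sym: "S P Q = S Q P" if "P \<in> g" "Q \<in> g" for P Q
  proof -
    have "D P Q - D Q P = D' P Q - D' Q P"
      using D D' that by (simp add: levi_civita_def)
    then show ?thesis by (simp add: S_def algebra_simps)
  qed
  have ip_add: "ip (P + Q) Z = ip P Z + ip Q Z" if "P \<in> g" "Q \<in> g" "Z \<in> g" for P Q Z
    using ip_bilinear that unfolding real_bilinear_on_def linear_on_def by blast
  have ip_diff: "ip (P - Q) Z = ip P Z - ip Q Z" if "P \<in> g" "Q \<in> g" "Z \<in> g" for P Q Z
    using ip_add[of "P - Q" Q Z] that sub by (simp add: subspace_diff)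
  have S_skew: "ip (S P Q) Z = - ip (S P Z) Q" if PQZ: "P \<in> g" "Q \<in> g" "Z \<in> g" for P Q Z
  proof -
    have "ip (D P Q) Z + ip Q (D P Z) = 0" "ip (D' P Q) Z + ip Q (D' P Z) = 0"
      using D D' PQZ by (auto simp: levi_civita_def)
    moreover have "ip Q (D P Z) = ip (D P Z) Q" "ip Q (D' P Z) = ip (D' P Z) Q"
      using PQZ cl by (auto intro: ip_symmetric)
    ultimately show ?thesis
      unfolding S_def using PQZ cl by (simp add: ip_diff)
  qed
  have zero: "ip (S X Y) Z = 0" if Z: "Z \<in> g" for Z
    using S_skew[of X Y Z] S_skew[of Z X Y] S_skew[of Y Z X] S_sym[of X Y] S_sym[of Y Z] S_sym[of X Z] X Y Z
    by simp
  have "S X Y = 0"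
    using zero[of "S X Y"] ip_positive[of "S X Y"] S_cl[OF X Y] by force
  then show ?thesis by (simp add: S_def)
qed

definition curvature :: "('a \<Rightarrow> 'a \<Rightarrow> 'a) \<Rightarrow> 'a \<Rightarrow> 'a \<Rightarrow> 'a \<Rightarrow> 'a"
  where "curvature D X Y Z = D X (D Y Z) - D Y (D X Z) - D (br X Y) Z"

definition ricci :: "('a \<Rightarrow> 'a \<Rightarrow> 'a) \<Rightarrow> 'a \<Rightarrow> 'a \<Rightarrow> real"
  where "ricci D X Y = trace_on g (\<lambda>Z. curvature D Z X Y)"

text \<open>
  The Ricci operator \<open>Ric\<close> is the endomorphism with \<open>ip (Ric X) Y = ricci D X Y\<close>, where \<open>D\<close> is
  the Levi-Civita connection. On \<open>g\<close>, \<open>D\<close> (by \<open>levi_civita_unique\<close>) and hence \<open>Ric\<close> are determined by \<open>ip\<close>.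
\<close>

definition negative_ricci :: bool
  where "negative_ricci \<longleftrightarrow>
    (\<exists>D Ric. levi_civita D \<and> real_linear_on g g Ric \<and>
       (\<forall>X\<in>g. \<forall>Y\<in>g. ip (Ric X) Y = ricci D X Y) \<and>
       (\<forall>X\<in>g. X \<noteq> 0 \<longrightarrow> ip (Ric X) X < 0))"

end


section \<open>Complex representations\<close>

text \<open>
  Representation spaces are finite-dimensional complex subspaces of \<open>nat \<Rightarrow> complex\<close>. Up to
  isomorphism these are all finite-dimensional complex vector spaces.
\<close>

instantiation "fun" :: (type, real_vector) real_vector
begin

definition scaleR_fun :: "real \<Rightarrow> ('a \<Rightarrow> 'b) \<Rightarrow> 'a \<Rightarrow> 'b"
  where "scaleR_fun r f = (\<lambda>x. r *\<^sub>R f x)"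

instance
  by standard (auto simp: scaleR_fun_def fun_eq_iff scaleR_add_right scaleR_add_left)

end

type_synonym cvec = "nat \<Rightarrow> complex"

definition cscale :: "complex \<Rightarrow> cvec \<Rightarrow> cvec"
  where "cscale c v = (\<lambda>i. c * v i)"

global_interpretation cvec: vector_space cscale
  by standard (auto simp: cscale_def fun_eq_iff algebra_simps)

text \<open>The complexification of \<open>u\<close>: the pair \<open>(X, Y)\<close> stands for \<open>X \<otimes> 1 + Y \<otimes> \<i>\<close>.\<close>

definition cplx_carrier :: "'a set \<Rightarrow> ('a \<times> 'a) set"
  where "cplx_carrier u = u \<times> u"

definition cplx_scale :: "complex \<Rightarrow> 'a::real_vector \<times> 'a \<Rightarrow> 'a \<times> 'a"
  where "cplx_scale c = (\<lambda>(X, Y). (Re c *\<^sub>R X - Im c *\<^sub>R Y, Re c *\<^sub>R Y + Im c *\<^sub>R X))"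

definition cplx_bracket ::
  "('a::real_vector \<Rightarrow> 'a \<Rightarrow> 'a) \<Rightarrow> 'a \<times> 'a \<Rightarrow> 'a \<times> 'a \<Rightarrow> 'a \<times> 'a"
  where "cplx_bracket br =
    (\<lambda>(X, Y) (X', Y'). (br X X' - br Y Y', br X Y' + br Y X'))"

type_synonym 'a cplx_rep = "cvec set \<times> ('a \<times> 'a \<Rightarrow> cvec \<Rightarrow> cvec)"

definition is_representation ::
  "'a::real_vector set \<Rightarrow> ('a \<Rightarrow> 'a \<Rightarrow> 'a) \<Rightarrow> 'a cplx_rep \<Rightarrow> bool"
  where "is_representation u br = (\<lambda>(V, \<pi>).
    (\<exists>B. finite B \<and> cvec.span B = V) \<and>
    (\<forall>A\<in>cplx_carrier u. linear_on cscale cscale V V (\<pi> A)) \<and>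
    (\<forall>v\<in>V. linear_on cplx_scale cscale (cplx_carrier u) V (\<lambda>A. \<pi> A v)) \<and>
    (\<forall>A\<in>cplx_carrier u. \<forall>B\<in>cplx_carrier u. \<forall>v\<in>V.
       \<pi> (cplx_bracket br A B) v = \<pi> A (\<pi> B v) - \<pi> B (\<pi> A v)))"

definition irreducible_rep ::
  "'a::real_vector set \<Rightarrow> ('a \<Rightarrow> 'a \<Rightarrow> 'a) \<Rightarrow> 'a cplx_rep \<Rightarrow> bool"
  where "irreducible_rep u br = (\<lambda>(V, \<pi>).
    is_representation u br (V, \<pi>) \<and> V \<noteq> {0} \<and>
    (\<forall>W. cvec.subspace W \<and> W \<subseteq> V \<and> (\<forall>A\<in>cplx_carrier u. \<pi> A ` W \<subseteq> W)
       \<longrightarrow> W = {0} \<or> W = V))"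

definition equivalent_rep :: "'a::real_vector set \<Rightarrow> 'a cplx_rep \<Rightarrow> 'a cplx_rep \<Rightarrow> bool"
  where "equivalent_rep u = (\<lambda>(V, \<pi>) (W, \<rho>).
    (\<exists>T. linear_on cscale cscale V W T \<and> bij_betw T V W \<and>
       (\<forall>A\<in>cplx_carrier u. \<forall>v\<in>V. T (\<pi> A v) = \<rho> A (T v))))"


section \<open>The Lie algebra of a real representation\<close>

text \<open>The triple \<open>(s, X, v)\<close> stands for \<open>s Z + X + v\<close>.\<close>

definition semidirect_carrier :: "'a set \<Rightarrow> 'v set \<Rightarrow> (real \<times> 'a \<times> 'v) set"
  where "semidirect_carrier u V = UNIV \<times> u \<times> V"

definition semidirect_bracket ::
  "('a \<Rightarrow> 'a \<Rightarrow> 'a) \<Rightarrow> ('a \<Rightarrow> 'v \<Rightarrow> 'v) \<Rightarrow>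
   real \<times> 'a \<times> 'v::real_vector \<Rightarrow> real \<times> 'a \<times> 'v \<Rightarrow> real \<times> 'a \<times> 'v"
  where "semidirect_bracket br \<pi> =
    (\<lambda>(s, X, v) (t, Y, w). (0, br X Y, (s *\<^sub>R w + \<pi> X w) - (t *\<^sub>R v + \<pi> Y v)))"

definition restrict_rep :: "('a::zero \<times> 'a \<Rightarrow> 'v \<Rightarrow> 'v) \<Rightarrow> 'a \<Rightarrow> 'v \<Rightarrow> 'v"
  where "restrict_rep \<pi> X = \<pi> (X, 0)"

definition admits_negative_ricci :: "'a::real_vector set \<Rightarrow> ('a \<Rightarrow> 'a \<Rightarrow> 'a) \<Rightarrow> bool"
  where "admits_negative_ricci g br \<longleftrightarrow>
    (\<exists>ip. metric_lie_algebra g br ip \<and> metric_lie_algebra.negative_ricci g br ip)"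

end

theory Submission
  imports Defs "HOL-Library.Nat_Bijection" "HOL-Computational_Algebra.Fundamental_Theorem_Algebra"
begin

text \<open>
  Every faithful representation \<open>V\<close> of \<open>u\<close> that leaves an inner product on \<open>V\<close> invariant gives a
  Lie algebra \<open>g = (\<real>Z + u) + V\<close> with a metric of negative Ricci curvature.  Take \<open>\<real>Z\<close>, \<open>u\<close> and \<open>V\<close>
  to be mutually orthogonal, use minus the Killing form \<open>q\<close> on \<open>u\<close>, some inner product \<open>p\<close> on \<open>V\<close>, and
  \<open>|Z|\<^sup>2 = 1 / \<zeta>\<close>.  Write \<open>S\<close> and \<open>A\<close> for the \<open>p\<close>-symmetric and \<open>p\<close>-skew parts of the action and
  \<open>N\<close> for the dimension of \<open>V\<close>.  For \<open>P = s Z + X + v\<close>, lemma \<open>ricci_diagonal\<close> computes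

  \<open>Ric(P, P) = - \<zeta> N p(v, v) - 2 (\<Sum>e. p(A\<^sub>e v, S\<^sub>e v)) + q(X, X) / 4 - N s\<^sup>2 - tr(S\<^sub>X\<^sup>2)\<close>

  with \<open>e\<close> running over an orthonormal basis of \<open>u\<close>.  A large \<open>\<zeta>\<close> makes the part in \<open>v\<close> negative, and
  what remains is the condition \<open>q(X, X) / 4 < tr(S\<^sub>X\<^sup>2)\<close> for \<open>X \<noteq> 0\<close>.  It does not involve
  \<open>\<zeta>\<close>, so \<open>p\<close> can be chosen first.  For the invariant inner product \<open>S = 0\<close>.  Rescaling the vectors of
  an orthonormal basis by the powers \<open>1, t, t\<^sup>2, \<dots>\<close> multiplies the matrix entries \<open>m\<^sub>x\<^sub>y\<close> of \<open>X\<close> by powers of \<open>t\<close>; since the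
  matrix was skew, every nonzero entry contributes at least \<open>(t - 1)\<^sup>2 m\<^sub>x\<^sub>y\<^sup>2 / 4\<close> to \<open>tr(S\<^sub>X\<^sup>2)\<close>.
  Faithfulness makes \<open>\<Sum> m\<^sub>x\<^sub>y\<^sup>2\<close> a positive definite form on \<open>u\<close>, which dominates \<open>q\<close> up to a
  constant, so a large \<open>t\<close> suffices (lemma \<open>admits_negative_ricci_of_skew_faithful\<close>).

  It remains to find infinitely many inequivalent faithful irreducible representations with an
  invariant inner product.  They are found inside tensor powers of the adjoint representation, with no
  structure theory beyond minimal ideals.  Distinct minimal ideals commute and are orthogonal,
  so there are finitely many.  Choose a nonzero \<open>X\<^sub>I\<close> in each minimal ideal \<open>I\<close>.  Being
  skew and nonzero, \<open>ad X\<^sub>I\<close> has an eigenvector in \<open>I \<otimes> \<complex>\<close> with an eigenvalue \<open>c\<^sub>I \<noteq> 0\<close>, and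
  that eigenvector is annihilated by all other chosen elements.  Tensor products of these
  eigenvectors are common eigenvectors of the \<open>X\<^sub>I\<close>, with eigenvalues \<open>n\<^sub>I c\<^sub>I\<close> for any prescribed
  multiplicities \<open>n\<^sub>I\<close>.  A minimal invariant subspace containing such a common eigenvector is
  irreducible, because orthogonal projection to an invariant subspace preserves the eigenvector
  equations.  If all \<open>n\<^sub>I\<close> are positive it is faithful: its kernel is an ideal containing
  none of the \<open>X\<^sub>I\<close>.  Letting one \<open>n\<^sub>I\<close> tend to infinity makes the spectral radius of
  \<open>X\<^sub>I\<close> unbounded on these representations, and the spectral radius is an invariant of equivalence.
\<close>

section \<open>Traces, subspaces and orthonormal frames\<close>

lemma linear_on_scaleR_sum:
  assumes f: "real_linear_on S T f" and S: "subspace S" and x: "\<And>i. i \<in> I \<Longrightarrow> x i \<in> S"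
  shows "f (\<Sum>i\<in>I. c i *\<^sub>R x i) = (\<Sum>i\<in>I. c i *\<^sub>R f (x i))"
proof -
  have f0: "f 0 = 0"
    using f subspace_0[OF S] unfolding linear_on_def by (metis scale_zero_left)
  show ?thesis
    using x
  proof (induction I rule: infinite_finite_induct)
    case (insert i I)
    then have "(\<Sum>i\<in>I. c i *\<^sub>R x i) \<in> S"
      by (auto intro!: subspace_sum[OF S] subspace_scale[OF S])
    then show ?case
      using insert f subspace_scale[OF S] by (auto simp: linear_on_def)
  qed (auto simp: f0)
qed

lemma real_linear_on_linear: "linear f \<Longrightarrow> f \<in> S \<rightarrow> T \<Longrightarrow> real_linear_on S T f"
  by (auto simp: linear_on_def linear_add linear_scale)

text \<open>
  The trace can be read off any finite spanning family with linear coefficient functionals: expand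
  the matrix entries in the basis underlying \<^const>\<open>trace_on\<close> and exchange the two sums.  This one
  formula covers both bases with their coordinates and orthonormal frames.
\<close>
lemma trace_on_dual_frame:
  fixes T :: "'a::real_vector set"
  assumes B: "finite B" "span B = T"
    and phi: "\<And>b. b \<in> B \<Longrightarrow> real_linear_on T UNIV (\<phi> b)"
    and exp: "\<And>x. x \<in> T \<Longrightarrow> (\<Sum>b\<in>B. \<phi> b x *\<^sub>R b) = x"
    and f: "real_linear_on T T f"
  shows "trace_on T f = (\<Sum>b\<in>B. \<phi> b (f b))"
proof -
  define C where "C = (SOME C. independent C \<and> span C = T)"
  have sub: "subspace T" using B(2) by (metis subspace_span)
  obtain C' where "C' \<subseteq> T" "independent C'" "T \<subseteq> span C'"
    by (rule maximal_independent_subset)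
  then have "\<exists>C. independent C \<and> span C = T"
    by (metis span_minimal sub subset_antisym)
  then have C: "independent C" "span C = T"
    unfolding C_def by (metis (mono_tags, lifting) someI_ex)+
  have finC: "finite C"
    using independent_span_bound[OF B(1) C(1)] C(2) B(2) span_superset[of C] by auto
  have BT: "B \<subseteq> T" "C \<subseteq> T" using B(2) C(2) span_superset by blast+
  have fT: "f x \<in> T" if "x \<in> T" for x using f that by (auto simp: linear_on_def)
  have "trace_on T f = (\<Sum>c\<in>C. representation C (f c) c)"
    by (simp add: trace_on_def Let_def C_def)
  also have "\<dots> = (\<Sum>c\<in>C. \<Sum>b\<in>B. \<phi> b (f c) * representation C b c)"
  proof (rule sum.cong[OF refl])
    fix c assume c: "c \<in> C"
    then have fc: "f c \<in> T" using BT fT by auto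
    have "representation C (f c) = representation C (\<Sum>b\<in>B. \<phi> b (f c) *\<^sub>R b)"
      using exp[OF fc] by simp
    also have "\<dots> = (\<lambda>x. \<Sum>b\<in>B. representation C (\<phi> b (f c) *\<^sub>R b) x)"
      using BT C by (intro representation_sum) (auto intro: span_scale)
    finally show "representation C (f c) c = (\<Sum>b\<in>B. \<phi> b (f c) * representation C b c)"
      using BT C by (auto simp: representation_scale intro!: sum.cong)
  qed
  also have "\<dots> = (\<Sum>b\<in>B. \<Sum>c\<in>C. representation C b c * \<phi> b (f c))"
    by (subst sum.swap) (simp add: mult.commute)
  also have "\<dots> = (\<Sum>b\<in>B. \<phi> b (f b))"
  proof (rule sum.cong[OF refl])
    fix b assume b: "b \<in> B"
    have rb: "(\<Sum>c\<in>C. representation C b c *\<^sub>R c) = b"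
      using sum_representation_eq[OF C(1) _ finC, of b] b BT C by auto
    have "\<phi> b (f b) = \<phi> b (f (\<Sum>c\<in>C. representation C b c *\<^sub>R c))"
      using rb by simp
    also have "\<dots> = \<phi> b (\<Sum>c\<in>C. representation C b c *\<^sub>R f c)"
      using BT by (subst linear_on_scaleR_sum[OF f sub]) auto
    also have "\<dots> = (\<Sum>c\<in>C. representation C b c *\<^sub>R \<phi> b (f c))"
      using BT fT by (subst linear_on_scaleR_sum[OF phi[OF b] sub]) auto
    finally show "(\<Sum>c\<in>C. representation C b c * \<phi> b (f c)) = \<phi> b (f b)" by simp
  qed
  finally show ?thesis .
qed

lemma trace_on_cong:
  assumes T: "subspace T" and f: "\<And>x. x \<in> T \<Longrightarrow> f x = g x"
  shows "trace_on T f = trace_on T g"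
proof -
  define B where "B = (SOME B. independent B \<and> span B = T)"
  obtain B' where "B' \<subseteq> T" "independent B'" "T \<subseteq> span B'" by (rule maximal_independent_subset)
  then have "\<exists>B. independent B \<and> span B = T"
    by (metis span_minimal T subset_antisym)
  then have "span B = T" unfolding B_def by (metis (mono_tags, lifting) someI_ex)
  then have "f b = g b" if "b \<in> B" for b using that f span_base by blast
  then show ?thesis by (simp add: trace_on_def Let_def flip: B_def)
qed

lemma exists_linear_projection:
  fixes T :: "'a::real_vector set"
  assumes "subspace T"
  obtains P where "linear P" "\<And>x. P x \<in> T" "\<And>x. x \<in> T \<Longrightarrow> P x = x"
proof -
  have "\<exists>g. g ` UNIV \<subseteq> T \<and> linear g \<and> (\<forall>v\<in>T. g (id v) = v)"
    by (rule linear_exists_left_inverse_on) (simp_all add: assms linear_iff)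
  then show ?thesis using that by (metis id_apply range_subsetD)
qed

lemma subspace_dim_less:
  fixes T :: "'a::real_vector set"
  assumes S: "subspace S" and T: "subspace T" and ST: "S \<subset> T" and fin: "finite B" "T \<subseteq> span B"
  shows "dim S < dim T"
proof -
  obtain C where C: "C \<subseteq> S" "independent C" "S \<subseteq> span C" by (rule maximal_independent_subset)
  obtain D where D: "C \<subseteq> D" "D \<subseteq> T" "independent D" "T \<subseteq> span D"
    using maximal_independent_subset_extend[of C T] C ST by (metis order.trans psubset_imp_subset)
  have "finite D" using independent_span_bound[OF fin(1) D(3)] D(2) fin(2) by auto
  moreover have "C \<noteq> D"
  proof
    assume "C = D"
    then have "T \<subseteq> S" using D C S by (metis order.trans span_minimal)
    then show False using ST by auto
  qed
  ultimately have "card C < card D" using D(1) by (simp add: psubset_card_mono psubsetI)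
  moreover have "card C = dim S" "card D = dim T"
    using basis_card_eq_dim[of C S] basis_card_eq_dim[of D T] C D by auto
  ultimately show ?thesis by simp
qed

text \<open>
  Used for minimal ideals and for minimal invariant subspaces.
\<close>
lemma exists_minimal_subspace:
  fixes T :: "'a::real_vector set"
  assumes T: "P T" "T \<subseteq> span B" and B: "finite B" and P: "\<And>S. P S \<Longrightarrow> subspace S"
  obtains S where "P S" "S \<subseteq> T" "\<And>S'. P S' \<Longrightarrow> S' \<subseteq> S \<Longrightarrow> S' = S"
proof -
  have "\<exists>S. (P S \<and> S \<subseteq> T) \<and> (\<forall>S'. P S' \<and> S' \<subseteq> T \<longrightarrow> dim S \<le> dim S')"
    using ex_has_least_nat[of "\<lambda>S. P S \<and> S \<subseteq> T" T dim] T by auto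
  then obtain S where S: "P S" "S \<subseteq> T" "\<And>S'. P S' \<Longrightarrow> S' \<subseteq> T \<Longrightarrow> dim S \<le> dim S'"
    by blast
  show ?thesis
  proof (rule that[OF S(1,2)])
    fix S' assume S': "P S'" "S' \<subseteq> S"
    show "S' = S"
    proof (rule ccontr)
      assume "S' \<noteq> S"
      then have "dim S' < dim S"
        using subspace_dim_less[of S' S B] S S' P B T by blast
      then show False using S(3)[of S'] S' S(2) by auto
    qed
  qed
qed

lemmas bilinear_simps =
  bilinear_ladd bilinear_radd bilinear_lmul bilinear_rmul bilinear_lneg bilinear_rneg
  bilinear_lsub bilinear_rsub bilinear_lzero bilinear_rzero

lemma bilinear_sum_left: "bilinear h \<Longrightarrow> h (sum f I) y = (\<Sum>i\<in>I. h (f i) y)"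
  unfolding bilinear_def using linear_sum[of "\<lambda>x. h x y"] by auto

lemma bilinear_sum_right: "bilinear h \<Longrightarrow> h x (sum f I) = (\<Sum>i\<in>I. h x (f i))"
  unfolding bilinear_def using linear_sum[of "\<lambda>y. h x y"] by auto

lemma bilinearI:
  assumes "\<And>x x' y. h (x + x') y = h x y + h x' y" "\<And>c x y. h (c *\<^sub>R x) y = c *\<^sub>R h x y"
    "\<And>x y y'. h x (y + y') = h x y + h x y'" "\<And>c x y. h x (c *\<^sub>R y) = c *\<^sub>R h x y"
  shows "bilinear h"
  unfolding bilinear_def by (auto intro!: linearI assms)

text \<open>
  The form \<open>q\<close> is bilinear on the whole type but only its restriction to \<open>T\<close> is an inner product.
  This keeps bilinear algebra free of membership conditions.
\<close>
locale orthonormal_frame =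
  fixes q :: "'a::real_vector \<Rightarrow> 'a \<Rightarrow> real" and E T :: "'a set"
  assumes bil: "bilinear q" and symmetric: "q x y = q y x" and finite_frame: "finite E"
    and orthonormal: "e \<in> E \<Longrightarrow> e' \<in> E \<Longrightarrow> q e e' = (if e = e' then 1 else 0)"
    and span_frame: "span E = T"
begin

lemmas q_simps = bilinear_simps[OF bil]

lemma subspace_T: "subspace T"
  using span_frame by (metis subspace_span)

lemma frame_subset: "e \<in> E \<Longrightarrow> e \<in> T"
  using span_frame span_superset by blast

lemma q_sum_frame: "e \<in> E \<Longrightarrow> q (\<Sum>e\<in>E. c e *\<^sub>R e) e = c e"
proof -
  assume e: "e \<in> E"
  have "q (\<Sum>e\<in>E. c e *\<^sub>R e) e = (\<Sum>e'\<in>E. c e' * q e' e)"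
    by (simp add: bilinear_sum_left[OF bil] q_simps)
  also have "\<dots> = (\<Sum>e'\<in>E. if e' = e then c e' else 0)"
    using e by (intro sum.cong) (auto simp: orthonormal)
  finally show ?thesis using e finite_frame by simp
qed

lemma expansion: "x \<in> T \<Longrightarrow> (\<Sum>e\<in>E. q x e *\<^sub>R e) = x"
proof -
  assume "x \<in> T"
  then obtain c where "x = (\<Sum>e\<in>E. c e *\<^sub>R e)"
    using span_frame span_finite[OF finite_frame] by auto
  then show ?thesis
    using q_sum_frame[of _ c] by simp
qed

lemma sum_in_T: "(\<Sum>e\<in>E. c e *\<^sub>R e) \<in> T"
  using frame_subset by (auto intro!: subspace_sum[OF subspace_T] subspace_scale[OF subspace_T])

lemma parseval: "x \<in> T \<Longrightarrow> (\<Sum>e\<in>E. q x e * q y e) = q x y"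
proof -
  assume x: "x \<in> T"
  have "q x y = q (\<Sum>e\<in>E. q x e *\<^sub>R e) y" using expansion[OF x] by simp
  also have "\<dots> = (\<Sum>e\<in>E. q x e * q y e)"
    by (simp add: bilinear_sum_left[OF bil] bilinear_lmul[OF bil] symmetric[of y])
  finally show ?thesis by simp
qed

lemma nonneg: "x \<in> T \<Longrightarrow> q x x \<ge> 0"
  by (subst parseval[symmetric]) (auto intro: sum_nonneg)

lemma eq_0_iff: "x \<in> T \<Longrightarrow> q x x = 0 \<longleftrightarrow> x = 0"
proof
  assume x: "x \<in> T" "q x x = 0"
  then have "\<forall>e\<in>E. q x e * q x e = 0"
    using parseval[of x x] finite_frame by (simp add: sum_nonneg_eq_0_iff)
  then have "(\<Sum>e\<in>E. q x e *\<^sub>R e) = 0" by (intro sum.neutral) auto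
  then show "x = 0" unfolding expansion[OF x(1)] .
qed (use bilinear_lzero[OF bil] in blast)

lemma positive: "x \<in> T \<Longrightarrow> x \<noteq> 0 \<Longrightarrow> q x x > 0"
  by (metis eq_0_iff nonneg order_less_le)

lemma frame_eqI:
  assumes "x \<in> T" "y \<in> T" "\<And>e. e \<in> E \<Longrightarrow> q x e = q y e"
  shows "x = y"
proof -
  have "(\<Sum>e\<in>E. q x e *\<^sub>R e) = (\<Sum>e\<in>E. q y e *\<^sub>R e)"
    using assms(3) by (intro sum.cong) auto
  then show ?thesis unfolding expansion[OF assms(1)] expansion[OF assms(2)] .
qed

lemma trace: "real_linear_on T T f \<Longrightarrow> trace_on T f = (\<Sum>e\<in>E. q (f e) e)"
  by (rule trace_on_dual_frame[OF finite_frame span_frame, where \<phi> = "\<lambda>e x. q x e"])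
    (auto simp: linear_on_def bilinear_ladd[OF bil] bilinear_lmul[OF bil] expansion)

text \<open>
  An elementary substitute for compactness of the unit sphere: in an orthonormal frame every coordinate
  product is at most \<open>q x x\<close>.
\<close>
lemma quadratic_form_bounded:
  assumes b: "bilinear b"
  obtains C :: real where "C \<ge> 0" "\<And>x. x \<in> T \<Longrightarrow> b x x \<le> C * q x x"
proof (rule that)
  let ?C = "\<Sum>e\<in>E. \<Sum>e'\<in>E. \<bar>b e e'\<bar>"
  show "?C \<ge> 0" by (simp add: sum_nonneg)
  fix x assume x: "x \<in> T"
  have le: "(q x e)\<^sup>2 \<le> q x x" if "e \<in> E" for e
    using parseval[OF x, of x] that finite_frame
      member_le_sum[of e E "\<lambda>e. q x e * q x e"] by (auto simp: power2_eq_square)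
  have "b x x = b (\<Sum>e\<in>E. q x e *\<^sub>R e) (\<Sum>e\<in>E. q x e *\<^sub>R e)"
    using expansion[OF x] by simp
  also have "\<dots> = (\<Sum>e\<in>E. \<Sum>e'\<in>E. q x e * q x e' * b e e')"
    by (simp only: bilinear_sum_left[OF b]) (simp add: bilinear_sum_right[OF b] bilinear_lmul[OF b] bilinear_rmul[OF b]
        sum_distrib_left algebra_simps)
  also have "\<dots> \<le> (\<Sum>e\<in>E. \<Sum>e'\<in>E. q x x * \<bar>b e e'\<bar>)"
  proof (intro sum_mono)
    fix e e' assume e: "e \<in> E" "e' \<in> E"
    have "\<bar>q x e * q x e'\<bar> \<le> q x x"
      using le[OF e(1)] le[OF e(2)] sum_squares_bound[of "\<bar>q x e\<bar>" "\<bar>q x e'\<bar>"]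
      by (simp add: abs_mult)
    then have "\<bar>q x e * q x e'\<bar> * \<bar>b e e'\<bar> \<le> q x x * \<bar>b e e'\<bar>"
      by (rule mult_right_mono) simp
    then show "q x e * q x e' * b e e' \<le> q x x * \<bar>b e e'\<bar>"
      by (metis abs_ge_self abs_mult order.trans)
  qed
  also have "\<dots> = ?C * q x x"
    by (simp add: sum_distrib_left mult.commute)
  finally show "b x x \<le> ?C * q x x" .
qed

lemma orthogonal_projection:
  obtains y where "y \<in> T" "\<And>t. t \<in> T \<Longrightarrow> q (x - y) t = 0"
proof (rule that)
  let ?y = "\<Sum>e\<in>E. q x e *\<^sub>R e"
  show "?y \<in> T" by (rule sum_in_T)
  have e: "q (x - ?y) e = 0" if "e \<in> E" for e
    using q_sum_frame[OF that, of "q x"] by (simp add: q_simps)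
  fix t assume "t \<in> T"
  then have "q (x - ?y) t = q (x - ?y) (\<Sum>e\<in>E. q t e *\<^sub>R e)" using expansion by simp
  also have "\<dots> = 0"
    by (subst bilinear_sum_right[OF bil]) (simp only: bilinear_rmul[OF bil] e, simp add: e)
  finally show "q (x - ?y) t = 0" .
qed

end

lemma gram_schmidt:
  assumes bil: "bilinear q" and sym: "\<And>x y. q x y = q y x" and fin: "finite B"
    and pos: "\<And>x. x \<in> span B \<Longrightarrow> x \<noteq> 0 \<Longrightarrow> q x x > (0::real)"
  obtains E where "orthonormal_frame q E (span B)"
proof -
  have "\<exists>E. orthonormal_frame q E (span B)"
    using fin pos
  proof (induction B)
    case empty
    show ?case
    proof
      show "orthonormal_frame q {} (span {})"
      proof unfold_locales
        show "q x y = q y x" for x y by (rule sym)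
      qed (use bil in auto)
    qed
  next
    case (insert b B)
    then obtain E where "orthonormal_frame q E (span B)"
      using span_mono[of B "insert b B"] by (meson subset_insertI subsetD)
    then interpret orthonormal_frame q E "span B" .
    obtain y where y: "y \<in> span B" "\<And>t. t \<in> span B \<Longrightarrow> q (b - y) t = 0"
      using orthogonal_projection[of b] by blast
    show ?case
    proof (cases "b = y")
      case True
      then have "span (insert b B) = span B"
        using y(1) by (simp add: span_redundant)
      then show ?thesis using orthonormal_frame_axioms by metis
    next
      case False
      define n where "n = (1 / sqrt (q (b - y) (b - y))) *\<^sub>R (b - y)"
      have by_in: "b - y \<in> span (insert b B)"
        using y(1) by (meson insertI1 span_base span_diff span_mono subset_insertI subsetD)
      have p: "q (b - y) (b - y) > 0"
        using insert.prems[OF by_in] False by simp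
      have nn: "q n n = 1"
        unfolding n_def using p
        by (simp only: bilinear_lmul[OF bil] bilinear_rmul[OF bil]) (simp add: field_simps flip: power2_eq_square)
      have ne: "q n e = 0" "q e n = 0" if "e \<in> E" for e
      proof -
        show "q n e = 0" unfolding n_def
          by (simp only: bilinear_lmul[OF bil] y(2)[OF frame_subset[OF that]]) simp
        then show "q e n = 0" using sym by simp
      qed
      have "span (insert n E) = span (insert b B)"
      proof
        have "n \<in> span (insert b B)" unfolding n_def using by_in by (rule span_scale)
        moreover have "E \<subseteq> span (insert b B)"
          using frame_subset span_mono[of B "insert b B"] by blast
        ultimately show "span (insert n E) \<subseteq> span (insert b B)"
          by (simp add: span_minimal)
        have "b = sqrt (q (b - y) (b - y)) *\<^sub>R n + y"
          unfolding n_def using p by simp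
        moreover have "y \<in> span (insert n E)"
          using y(1) span_frame span_mono[of E "insert n E"] by blast
        ultimately have "b \<in> span (insert n E)"
          by (metis insertI1 span_add span_base span_scale)
        moreover have "B \<subseteq> span (insert n E)"
          using span_frame span_mono[of E "insert n E"] span_superset[of B] by blast
        ultimately show "span (insert b B) \<subseteq> span (insert n E)"
          by (simp add: span_minimal)
      qed
      moreover have "orthonormal_frame q (insert n E) (span (insert n E))"
      proof unfold_locales
        show "q e e' = (if e = e' then 1 else 0)" if "e \<in> insert n E" "e' \<in> insert n E" for e e'
          using that nn ne orthonormal by (cases "e = n"; cases "e' = n") auto
        show "q x y = q y x" for x y by (rule sym)
      qed (use bil finite_frame in auto)
      ultimately show ?thesis by auto
    qed
  qed
  then show ?thesis using that by blast
qed

section \<open>Ricci curvature of the semidirect product\<close>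

lemma real_bilinear_on_bilinear:
  assumes "bilinear f" "\<And>x y. x \<in> S \<Longrightarrow> y \<in> T \<Longrightarrow> f x y \<in> U"
  shows "real_bilinear_on S T U f"
  using assms by (auto simp: real_bilinear_on_def linear_on_def bilinear_simps)

text \<open>
  A compact semisimple Lie algebra with \<open>q\<close> equal to minus its Killing form, which is what the
  last assumption expresses.  Bracket and form are extended from \<open>u\<close> to the whole type
  (by composing with a projection onto \<open>u\<close>), so that their algebraic laws hold without membership conditions.
\<close>
locale compact_lie = U: orthonormal_frame q E u
  for q :: "'a::real_vector \<Rightarrow> 'a \<Rightarrow> real" and E u +
  fixes br :: "'a \<Rightarrow> 'a \<Rightarrow> 'a"
  assumes br: "bilinear br" "br X Y \<in> u" "br X X = 0"
    "br X (br Y Z) + br Y (br Z X) + br Z (br X Y) = 0"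
    and invariant: "q (br X Y) Z = - q Y (br X Z)"
    and killing: "X \<in> u \<Longrightarrow> Y \<in> u \<Longrightarrow> (\<Sum>e\<in>E. q (br e X) (br e Y)) = q X Y"
begin

lemmas q_lin = bilinear_simps[OF U.bil]
lemmas br_lin = bilinear_simps[OF br(1)]

lemma br_skew: "br X Y = - br Y X"
proof -
  have "br X Y + br Y X = 0"
    using br(3)[of "X + Y"] br(3)[of X] br(3)[of Y] by (simp add: br_lin add.commute)
  then show ?thesis by (simp add: eq_neg_iff_add_eq_0)
qed

lemma br_br: "br (br X Y) Z = br X (br Y Z) - br Y (br X Z)"
  using br(4)[of X Y Z] br_skew[of Z "br X Y"] br_skew[of Z X]
  by (simp add: br_lin algebra_simps)

end

text \<open>
  The vanishing trace reflects that \<open>u\<close> is semisimple.  It makes the mean curvature vector of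
  the semidirect product a multiple of \<open>Z\<close>.
\<close>
locale semidirect_data =
  compact_lie q E u br + W: orthonormal_frame p W V
  for q :: "'a::real_vector \<Rightarrow> 'a \<Rightarrow> real" and E u br
    and p :: "'v::real_vector \<Rightarrow> 'v \<Rightarrow> real" and W V +
  fixes \<pi> :: "'a \<Rightarrow> 'v \<Rightarrow> 'v"
  assumes rep: "bilinear \<pi>" "X \<in> u \<Longrightarrow> v \<in> V \<Longrightarrow> \<pi> X v \<in> V"
      "X \<in> u \<Longrightarrow> Y \<in> u \<Longrightarrow> v \<in> V \<Longrightarrow> \<pi> (br X Y) v = \<pi> X (\<pi> Y v) - \<pi> Y (\<pi> X v)"
    and trace_rep: "X \<in> u \<Longrightarrow> (\<Sum>w\<in>W. p (\<pi> X w) w) = 0"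
begin

lemmas p_lin = bilinear_simps[OF W.bil]
lemmas rep_lin = bilinear_simps[OF rep(1)]

text \<open>
  The transpose of the action with respect to \<open>p\<close>.
\<close>
definition adj :: "'a \<Rightarrow> 'v \<Rightarrow> 'v"
  where "adj X v = (\<Sum>w\<in>W. p v (\<pi> X w) *\<^sub>R w)"

definition S :: "'a \<Rightarrow> 'v \<Rightarrow> 'v"
  where "S X v = (1/2) *\<^sub>R (\<pi> X v + adj X v)"

definition A :: "'a \<Rightarrow> 'v \<Rightarrow> 'v"
  where "A X v = (1/2) *\<^sub>R (\<pi> X v - adj X v)"

text \<open>
  The \<open>u\<close>-component of the covariant derivative of \<open>w\<close> along \<open>v\<close>, characterised by
  \<open>q (\<Phi> v w) X = p (S X v) w\<close>.
\<close>
definition \<Phi> :: "'v \<Rightarrow> 'v \<Rightarrow> 'a"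
  where "\<Phi> v w = (\<Sum>e\<in>E. p (S e v) w *\<^sub>R e)"

lemma bilinear_adj: "bilinear adj"
  by (rule bilinearI)
    (auto simp: adj_def rep_lin p_lin scaleR_left_distrib sum.distrib scaleR_sum_right)

lemma adj_in: "adj X v \<in> V"
  unfolding adj_def by (rule W.sum_in_T)

lemma adj: "w \<in> V \<Longrightarrow> p (adj X v) w = p v (\<pi> X w)"
proof -
  assume w: "w \<in> V"
  have "p v (\<pi> X w) = p v (\<pi> X (\<Sum>x\<in>W. p w x *\<^sub>R x))"
    using W.expansion[OF w] by simp
  also have "\<dots> = (\<Sum>x\<in>W. p w x * p v (\<pi> X x))"
    by (simp add: bilinear_sum_right[OF rep(1)] bilinear_sum_right[OF W.bil] rep_lin p_lin)
  also have "\<dots> = p (adj X v) w"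
    by (simp add: adj_def bilinear_sum_left[OF W.bil] p_lin W.symmetric[of w] mult.commute)
  finally show ?thesis by simp
qed

lemma bilinear_S: "bilinear S" and bilinear_A: "bilinear A"
  by (rule bilinearI; simp add: S_def A_def rep_lin bilinear_simps[OF bilinear_adj] algebra_simps)+

lemmas S_lin = bilinear_simps[OF bilinear_S]
lemmas A_lin = bilinear_simps[OF bilinear_A]

lemma S_in: "X \<in> u \<Longrightarrow> v \<in> V \<Longrightarrow> S X v \<in> V" and A_in: "X \<in> u \<Longrightarrow> v \<in> V \<Longrightarrow> A X v \<in> V"
  unfolding S_def A_def
  by (auto intro!: subspace_scale[OF W.subspace_T] subspace_add[OF W.subspace_T]
      subspace_diff[OF W.subspace_T] rep adj_in)

lemma S_plus_A: "\<pi> X v = S X v + A X v"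
  unfolding S_def A_def by (simp add: algebra_simps flip: scaleR_add_left)

lemma S_sym: "v \<in> V \<Longrightarrow> w \<in> V \<Longrightarrow> p (S X v) w = p v (S X w)"
  unfolding S_def
  using adj[of v X w] adj[of w X v] W.symmetric[of v "adj X w"] W.symmetric[of w "\<pi> X v"]
  by (simp add: p_lin)

lemma A_skew: "v \<in> V \<Longrightarrow> w \<in> V \<Longrightarrow> p (A X v) w = - p v (A X w)"
  unfolding A_def
  using adj[of v X w] adj[of w X v] W.symmetric[of v "adj X w"] W.symmetric[of w "\<pi> X v"]
  by (simp add: p_lin field_simps)

lemma A_diag: "v \<in> V \<Longrightarrow> p (A X v) v = 0"
  using A_skew[of v v X] W.symmetric[of v "A X v"] by simp

lemma bilinear_\<Phi>: "bilinear \<Phi>"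
  by (rule bilinearI)
    (auto simp: \<Phi>_def S_lin p_lin scaleR_left_distrib sum.distrib scaleR_sum_right)

lemmas \<Phi>_lin = bilinear_simps[OF bilinear_\<Phi>]

lemma \<Phi>_in: "\<Phi> v w \<in> u"
  unfolding \<Phi>_def by (rule U.sum_in_T)

lemma \<Phi>: "X \<in> u \<Longrightarrow> q (\<Phi> v w) X = p (S X v) w"
proof -
  assume X: "X \<in> u"
  have "p (S X v) w = p (S (\<Sum>e\<in>E. q X e *\<^sub>R e) v) w"
    using U.expansion[OF X] by simp
  also have "\<dots> = (\<Sum>e\<in>E. q X e * p (S e v) w)"
    by (simp add: bilinear_sum_left[OF bilinear_S] bilinear_sum_left[OF W.bil] S_lin p_lin)
  also have "\<dots> = q (\<Phi> v w) X"
    by (simp add: \<Phi>_def bilinear_sum_left[OF U.bil] q_lin U.symmetric[of X] mult.commute)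
  finally show ?thesis by simp
qed

lemma \<Phi>_sym: "v \<in> V \<Longrightarrow> w \<in> V \<Longrightarrow> \<Phi> v w = \<Phi> w v"
  unfolding \<Phi>_def using S_sym[of v w] W.symmetric by (metis (no_types, lifting))

lemma trace_S: "X \<in> u \<Longrightarrow> (\<Sum>w\<in>W. p (S X w) w) = 0"
proof -
  assume X: "X \<in> u"
  have "p (S X w) w = p (\<pi> X w) w" if "w \<in> W" for w
    using A_diag[OF W.frame_subset[OF that]] by (simp add: S_plus_A p_lin)
  then show ?thesis using trace_rep[OF X] by simp
qed

text \<open>
  A trace of a symmetric times a skew operator; concretely, \<open>\<pi> X\<close> and its transpose have the same
  Frobenius norm.
\<close>
lemma trace_SA: "X \<in> u \<Longrightarrow> (\<Sum>w\<in>W. p (S X w) (A X w)) = 0"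
proof -
  assume X: "X \<in> u"
  have "(\<Sum>w\<in>W. p (adj X w) (adj X w)) = (\<Sum>w\<in>W. \<Sum>x\<in>W. (p (adj X w) x)\<^sup>2)"
    using W.parseval[OF adj_in] by (simp add: power2_eq_square)
  also have "\<dots> = (\<Sum>w\<in>W. \<Sum>x\<in>W. (p (\<pi> X x) w)\<^sup>2)"
    using adj W.frame_subset by (simp add: W.symmetric)
  also have "\<dots> = (\<Sum>x\<in>W. \<Sum>w\<in>W. (p (\<pi> X x) w)\<^sup>2)"
    by (rule sum.swap)
  also have "\<dots> = (\<Sum>x\<in>W. p (\<pi> X x) (\<pi> X x))"
    using W.parseval[OF rep(2)[OF X W.frame_subset]] by (simp add: power2_eq_square)
  finally have eq: "(\<Sum>w\<in>W. p (adj X w) (adj X w)) = (\<Sum>x\<in>W. p (\<pi> X x) (\<pi> X x))" .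
  have "4 * p (S X w) (A X w) = p (\<pi> X w) (\<pi> X w) - p (adj X w) (adj X w)" for w
    unfolding S_def A_def
    using W.symmetric[of "\<pi> X w" "adj X w"] by (simp add: p_lin field_simps)
  then have "4 * (\<Sum>w\<in>W. p (S X w) (A X w)) = 0"
    using eq by (simp add: sum_subtractf sum_distrib_left)
  then show ?thesis by simp
qed

lemma norm_S:
  assumes X: "X \<in> u"
  shows "4 * (\<Sum>w\<in>W. p (S X w) (S X w)) = (\<Sum>w\<in>W. \<Sum>x\<in>W. (p (\<pi> X w) x + p w (\<pi> X x))\<^sup>2)"
proof -
  have "p (\<pi> X w) x + p w (\<pi> X x) = 2 * p (S X w) x" if "x \<in> W" for w x
    using adj[OF W.frame_subset[OF that], of X w] by (simp add: S_def p_lin)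
  then have "(\<Sum>w\<in>W. \<Sum>x\<in>W. (p (\<pi> X w) x + p w (\<pi> X x))\<^sup>2) = (\<Sum>w\<in>W. \<Sum>x\<in>W. 4 * (p (S X w) x)\<^sup>2)"
    by (auto simp: power_mult_distrib intro!: sum.cong)
  also have "\<dots> = 4 * (\<Sum>w\<in>W. p (S X w) (S X w))"
    using W.parseval[OF S_in[OF X W.frame_subset]] by (simp add: power2_eq_square flip: sum_distrib_left)
  finally show ?thesis by simp
qed

end

text \<open>
  The parameter \<open>\<zeta>\<close> is \<open>1 / |Z|\<^sup>2\<close>.
\<close>
locale semidirect_metric = semidirect_data +
  fixes \<zeta> :: real
  assumes zeta: "\<zeta> > 0"
begin

abbreviation "g \<equiv> semidirect_carrier u V"
abbreviation "lb \<equiv> semidirect_bracket br \<pi>"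

definition ip :: "real \<times> 'a \<times> 'b \<Rightarrow> real \<times> 'a \<times> 'b \<Rightarrow> real"
  where "ip = (\<lambda>(s, X, v) (t, Y, w). s * t / \<zeta> + q X Y + p v w)"

text \<open>
  The solution of the Koszul formula for this metric: \<open>Z\<close> acts on \<open>V\<close> by a symmetric operator,
  an element of \<open>u\<close> differentiates \<open>V\<close> by its skew part, and the symmetric parts give the second
  fundamental form of \<open>V\<close>.
\<close>
definition D :: "real \<times> 'a \<times> 'b \<Rightarrow> real \<times> 'a \<times> 'b \<Rightarrow> real \<times> 'a \<times> 'b"
  where "D = (\<lambda>(s, X, v) (t, Y, w).
    (\<zeta> * p v w, (1/2) *\<^sub>R br X Y + \<Phi> v w, A X w - t *\<^sub>R v - S Y v))"

definition F :: "(real \<times> 'a \<times> 'b) set"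
  where "F = insert (sqrt \<zeta>, 0, 0) ((\<lambda>e. (0, e, 0)) ` E \<union> (\<lambda>w. (0, 0, w)) ` W)"

lemma bilinear_ip: "bilinear ip"
  by (rule bilinearI) (auto simp: ip_def q_lin p_lin algebra_simps add_divide_distrib)

lemma bilinear_D: "bilinear D"
  by (rule bilinearI) (auto simp: D_def br_lin p_lin \<Phi>_lin S_lin A_lin algebra_simps)

lemma bilinear_lb: "bilinear lb"
  by (rule bilinearI) (auto simp: semidirect_bracket_def br_lin rep_lin algebra_simps)

lemma mem_g: "(s, X, v) \<in> g \<longleftrightarrow> X \<in> u \<and> v \<in> V"
  by (simp add: semidirect_carrier_def)

lemma lb_in: "P \<in> g \<Longrightarrow> Q \<in> g \<Longrightarrow> lb P Q \<in> g"
  by (cases P; cases Q)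
    (auto simp: mem_g semidirect_bracket_def intro!: subspace_diff[OF W.subspace_T]
      subspace_add[OF W.subspace_T] subspace_scale[OF W.subspace_T] rep br)

lemma D_in: "P \<in> g \<Longrightarrow> Q \<in> g \<Longrightarrow> D P Q \<in> g"
  by (cases P; cases Q)
    (auto simp: mem_g D_def intro!: subspace_diff[OF W.subspace_T]
      subspace_add[OF U.subspace_T] subspace_scale[OF W.subspace_T] subspace_scale[OF U.subspace_T]
      A_in S_in \<Phi>_in br)

lemma zero_mem: "0 \<in> u" "0 \<in> V"
  using subspace_0[OF U.subspace_T] subspace_0[OF W.subspace_T] .

lemma F_subset: "b \<in> F \<Longrightarrow> b \<in> g"
  using U.frame_subset W.frame_subset subspace_0[OF U.subspace_T] subspace_0[OF W.subspace_T]
  by (auto simp: F_def mem_g)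

lemma span_F: "span F = g"
proof
  have "subspace g"
    using U.subspace_T W.subspace_T
    by (auto simp: subspace_def semidirect_carrier_def zero_prod_def)
  then show "span F \<subseteq> g"
    by (metis F_subset span_minimal subsetI)
  show "g \<subseteq> span F"
  proof
    fix P assume "P \<in> g"
    then obtain s X v where P: "P = (s, X, v)" "X \<in> u" "v \<in> V"
      by (auto simp: semidirect_carrier_def)
    have 1: "(s, 0, 0) \<in> span F"
    proof -
      have "(s / sqrt \<zeta>) *\<^sub>R (sqrt \<zeta>, 0, 0) \<in> span F"
        by (rule span_scale, rule span_base) (simp add: F_def)
      then show ?thesis using zeta by (simp add: zero_prod_def[symmetric])
    qed
    have "(0, X, 0) = (\<Sum>e\<in>E. q X e *\<^sub>R (0::real, e, 0::'b))"
      using U.expansion[OF P(2)] by (simp add: prod_eq_iff fst_sum snd_sum)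
    also have "\<dots> \<in> span F"
      by (intro span_sum span_scale span_base) (simp add: F_def)
    finally have 2: "(0, X, 0) \<in> span F" .
    have "(0, 0, v) = (\<Sum>w\<in>W. p v w *\<^sub>R (0::real, 0::'a, w))"
      using W.expansion[OF P(3)] by (simp add: prod_eq_iff fst_sum snd_sum)
    also have "\<dots> \<in> span F"
      by (intro span_sum span_scale span_base) (simp add: F_def)
    finally have 3: "(0, 0, v) \<in> span F" .
    have "P = (s, 0, 0) + (0, X, 0) + (0, 0, v)" using P by simp
    then show "P \<in> span F" using 1 2 3 by (metis span_add)
  qed
qed

lemma frame_F: "orthonormal_frame ip F g"
proof unfold_locales
  show "ip P Q = ip Q P" for P Q
    by (cases P; cases Q) (simp add: ip_def U.symmetric W.symmetric)
  show "finite F"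
    by (simp add: F_def U.finite_frame W.finite_frame)
  have nz: "0 \<notin> E" "0 \<notin> W"
    using U.orthonormal[of 0 0] W.orthonormal[of 0 0] by (auto simp: q_lin p_lin)
  show "ip e e' = (if e = e' then 1 else 0)" if "e \<in> F" "e' \<in> F" for e e'
    using that zeta nz
    by (auto simp: F_def ip_def q_lin p_lin U.orthonormal W.orthonormal real_sqrt_mult_self
        split: if_splits)
qed (rule bilinear_ip span_F)+

sublocale G: orthonormal_frame ip F g
  by (rule frame_F)

lemma metric_lie: "metric_lie_algebra g lb ip"
proof unfold_locales
  show "\<exists>B. finite B \<and> span B = g"
    using G.finite_frame G.span_frame by blast
  show "real_bilinear_on g g g lb"
    by (rule real_bilinear_on_bilinear[OF bilinear_lb lb_in])
  show "lb P P = 0" if "P \<in> g" for P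
    by (cases P) (simp add: semidirect_bracket_def br zero_prod_def)
  show "lb P (lb Q R) + lb Q (lb R P) + lb R (lb P Q) = 0" if "P \<in> g" "Q \<in> g" "R \<in> g" for P Q R
    using that br(4)[of "fst (snd P)" "fst (snd Q)" "fst (snd R)"]
    by (cases P; cases Q; cases R)
      (simp add: mem_g semidirect_bracket_def rep rep_lin zero_prod_def algebra_simps)
  show "real_bilinear_on g g UNIV ip"
    by (rule real_bilinear_on_bilinear[OF bilinear_ip]) simp
  show "ip P Q = ip Q P" for P Q by (rule G.symmetric)
  show "ip P P > 0" if "P \<in> g" "P \<noteq> 0" for P by (rule G.positive[OF that])
qed

sublocale M: metric_lie_algebra g lb ip
  by (rule metric_lie)

lemma levi_civita_D: "M.levi_civita D"
  unfolding M.levi_civita_def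
proof (intro conjI ballI)
  show "real_bilinear_on g g g D"
    by (rule real_bilinear_on_bilinear[OF bilinear_D D_in])
  fix P Q assume PQ: "P \<in> g" "Q \<in> g"
  obtain s X v t Y w where PQ': "P = (s, X, v)" "Q = (t, Y, w)" by (cases P; cases Q)
  show "D P Q - D Q P = lb P Q"
    using PQ \<Phi>_sym[of v w] W.symmetric[of v w] br_skew[of Y X]
    unfolding PQ' by (simp add: mem_g D_def semidirect_bracket_def S_plus_A flip: scaleR_add_left)
  fix R assume R: "R \<in> g"
  obtain r Z x where R': "R = (r, Z, x)" by (cases R)
  have "q (br X Y) Z = - q Y (br X Z)" by (rule invariant)
  then show "ip (D P Q) R + ip Q (D P R) = 0"
    using PQ R \<Phi>[of Z v w] \<Phi>[of Y v x] A_skew[of w x X] W.symmetric[of w v]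
      S_sym[of v x Y] W.symmetric[of w "S Z v"] U.symmetric[of Y "\<Phi> v x"] zeta
      W.symmetric[of w "S Z v"]
    unfolding PQ' R'
    by (simp add: mem_g D_def ip_def q_lin p_lin)
qed


lemma sum_F:
  "(\<Sum>b\<in>F. f b) = f (sqrt \<zeta>, 0, 0) + (\<Sum>e\<in>E. f (0, e, 0)) + (\<Sum>w\<in>W. f (0, 0, w))"
proof -
  have nz: "0 \<notin> E" "0 \<notin> W"
    using U.orthonormal[of 0 0] W.orthonormal[of 0 0] by (auto simp: q_lin p_lin)
  have inj: "inj_on (\<lambda>e. (0::real, e, 0::'b)) E" "inj_on (\<lambda>w. (0::real, 0::'a, w)) W"
    by (auto simp: inj_on_def)
  have "(\<Sum>b\<in>F. f b) = f (sqrt \<zeta>, 0, 0) + (\<Sum>b\<in>(\<lambda>e. (0, e, 0)) ` E \<union> (\<lambda>w. (0, 0, w)) ` W. f b)"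
    unfolding F_def using zeta by (subst sum.insert) (auto simp: U.finite_frame W.finite_frame)
  also have "(\<Sum>b\<in>(\<lambda>e. (0, e, 0)) ` E \<union> (\<lambda>w. (0, 0, w)) ` W. f b) =
      (\<Sum>b\<in>(\<lambda>e. (0, e, 0)) ` E. f b) + (\<Sum>b\<in>(\<lambda>w. (0, 0, w)) ` W. f b)"
    using nz by (subst sum.union_disjoint) (auto simp: U.finite_frame W.finite_frame)
  finally show ?thesis
    by (simp add: sum.reindex[OF inj(1)] sum.reindex[OF inj(2)] add.assoc)
qed

lemma curvature_linear:
  "bilinear (\<lambda>Z Y. M.curvature D Z P Y)" "bilinear (\<lambda>Z Y. M.curvature D Z Y P)"
  by (rule bilinearI; simp add: M.curvature_def bilinear_simps[OF bilinear_D] bilinear_simps[OF bilinear_lb]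
      algebra_simps)+

lemma curvature_in: "P \<in> g \<Longrightarrow> Q \<in> g \<Longrightarrow> R \<in> g \<Longrightarrow> M.curvature D P Q R \<in> g"
  unfolding M.curvature_def
  by (intro subspace_diff[OF G.subspace_T] D_in lb_in)

lemma ricci_sum: "P \<in> g \<Longrightarrow> Q \<in> g \<Longrightarrow> M.ricci D P Q = (\<Sum>b\<in>F. ip (M.curvature D b P Q) b)"
  unfolding M.ricci_def
  by (rule G.trace)
    (auto simp: linear_on_def curvature_in bilinear_simps[OF curvature_linear(1)])

text \<open>
  Metric compatibility moves the outer derivatives onto the other argument, so that only first
  covariant derivatives have to be evaluated.
\<close>
lemma sectional:
  assumes "b \<in> g" "P \<in> g"
  shows "ip (M.curvature D b P P) b =
    - ip (D P P) (D b b) + ip (D b P) (D P b) - ip (D (lb b P) P) b"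
proof -
  have "ip (D b (D P P)) b + ip (D P P) (D b b) = 0" "ip (D P (D b P)) b + ip (D b P) (D P b) = 0"
    using levi_civita_D assms D_in unfolding M.levi_civita_def by blast+
  then show ?thesis
    unfolding M.curvature_def by (simp add: bilinear_simps[OF bilinear_ip])
qed

lemma sectional_Z:
  assumes "X \<in> u" "v \<in> V"
  shows "ip (M.curvature D (sqrt \<zeta>, 0, 0) (s, X, v) (s, X, v)) (sqrt \<zeta>, 0, 0) = - \<zeta> * p v v"
proof -
  have mem: "(sqrt \<zeta>, 0, 0) \<in> g" "(s, X, v) \<in> g"
    using zero_mem assms U.frame_subset W.frame_subset by (auto simp: mem_g)
  show ?thesis
    unfolding sectional[OF mem]
    using zeta
    by (simp add: D_def ip_def semidirect_bracket_def br_lin rep_lin S_lin A_lin \<Phi>_lin q_lin p_lin)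
qed

lemma sectional_u:
  assumes "X \<in> u" "v \<in> V" "e \<in> E"
  shows "ip (M.curvature D (0, e, 0) (s, X, v) (s, X, v)) (0, e, 0) =
    1/4 * q (br e X) (br e X) - 2 * p (A e v) (S e v) - p (S e v) (S e v)"
proof -
  have mem: "(0, e, 0) \<in> g" "(s, X, v) \<in> g"
    using zero_mem assms U.frame_subset W.frame_subset by (auto simp: mem_g)
  have 1: "q (br (br e X) X) e = - q (br e X) (br e X)"
    using invariant[of X "br e X" e] br_skew[of "br e X" X] br_skew[of X e] by (simp add: q_lin)
  have 2: "p (S e (\<pi> e v)) v = p (S e v) (S e v) + p (A e v) (S e v)"
    using S_sym[of "\<pi> e v" v e] rep(2)[OF U.frame_subset[OF assms(3)] assms(2)] assms(2)
    by (simp add: S_plus_A p_lin)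
  have 3: "q (\<Phi> (\<pi> e v) v) e = p (S e (\<pi> e v)) v"
    by (rule \<Phi>[OF U.frame_subset[OF assms(3)]])
  have 4: "br X e = - br e X" by (rule br_skew)
  show ?thesis
    unfolding sectional[OF mem]
    by (simp add: D_def ip_def semidirect_bracket_def br_lin rep_lin S_lin A_lin \<Phi>_lin q_lin p_lin
        1 2 3 4 br(3) W.symmetric[of "S e v" "A e v"])
qed

lemma sectional_V:
  assumes "X \<in> u" "v \<in> V" "w \<in> W"
  shows "ip (M.curvature D (0, 0, w) (s, X, v) (s, X, v)) (0, 0, w) =
    - \<zeta> * p v v - q (\<Phi> v v) (\<Phi> w w) + \<zeta> * (p w v)\<^sup>2 + q (\<Phi> w v) (\<Phi> w v)
    - s\<^sup>2 - 2 * s * p (S X w) w - p (S X w) (S X w) - 2 * p (S X w) (A X w)"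
proof -
  have w: "w \<in> V" by (rule W.frame_subset[OF assms(3)])
  have mem: "(0, 0, w) \<in> g" "(s, X, v) \<in> g"
    using zero_mem assms U.frame_subset W.frame_subset by (auto simp: mem_g)
  have 1: "p (S X (A X w)) w = p (S X w) (A X w)" "p (S X (S X w)) w = p (S X w) (S X w)"
    using S_sym[of "A X w" w X] S_sym[of "S X w" w X] A_in[OF assms(1) w] S_in[OF assms(1) w] w
    by (simp_all add: W.symmetric)
  have 2: "p w w = 1" using W.orthonormal assms(3) by simp
  have 3: "\<Phi> v w = \<Phi> w v" using \<Phi>_sym assms(2) w by blast
  have 4: "p (A X w) w = 0" "p w (A X w) = 0" using A_diag[OF w] W.symmetric[of w] by simp_all
  have 5: "p w (S X w) = p (S X w) w" "p v w = p w v" "p (A X w) (S X w) = p (S X w) (A X w)"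
    by (rule W.symmetric)+
  show ?thesis
    unfolding sectional[OF mem]
    using zeta
    by (simp add: D_def ip_def semidirect_bracket_def br_lin rep_lin S_lin A_lin \<Phi>_lin q_lin p_lin
        S_plus_A br(3) 1 2 3 4 5 power2_eq_square algebra_simps)
qed

text \<open>
  Summing the three kinds of sectional terms.  In the sum over \<open>W\<close> the terms linear in \<open>S X\<close>
  and the products of \<open>S X\<close> with \<open>A X\<close> vanish as traces, and the squares of \<open>\<Phi>\<close> cancel
  the terms \<open>p (S e v) (S e v)\<close> coming from the sum over \<open>E\<close>.
\<close>
lemma ricci_diagonal:
  fixes s :: real
  assumes "X \<in> u" "v \<in> V"
  shows "M.ricci D (s, X, v) (s, X, v) =
    - \<zeta> * card W * p v v - 2 * (\<Sum>e\<in>E. p (A e v) (S e v)) + 1/4 * q X X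
    - card W * s\<^sup>2 - (\<Sum>w\<in>W. p (S X w) (S X w))"
proof -
  have mem: "(s, X, v) \<in> g" using assms by (simp add: mem_g)
  have 1: "(\<Sum>w\<in>W. q (\<Phi> v v) (\<Phi> w w)) = 0"
  proof -
    have "(\<Sum>w\<in>W. q (\<Phi> v v) (\<Phi> w w)) = (\<Sum>w\<in>W. p (S (\<Phi> v v) w) w)"
      using \<Phi>[OF \<Phi>_in] by (simp add: U.symmetric)
    then show ?thesis using trace_S[OF \<Phi>_in] by simp
  qed
  have 2: "(\<Sum>w\<in>W. q (\<Phi> w v) (\<Phi> w v)) = (\<Sum>e\<in>E. p (S e v) (S e v))"
  proof -
    have "(\<Sum>w\<in>W. q (\<Phi> w v) (\<Phi> w v)) = (\<Sum>w\<in>W. \<Sum>e\<in>E. (p (S e v) w)\<^sup>2)"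
    proof (rule sum.cong[OF refl])
      fix w assume w: "w \<in> W"
      have "q (\<Phi> w v) (\<Phi> w v) = (\<Sum>e\<in>E. (q (\<Phi> v w) e)\<^sup>2)"
        using U.parseval[OF \<Phi>_in] \<Phi>_sym[OF assms(2) W.frame_subset[OF w]]
        by (simp add: power2_eq_square)
      then show "q (\<Phi> w v) (\<Phi> w v) = (\<Sum>e\<in>E. (p (S e v) w)\<^sup>2)"
        using \<Phi>[OF U.frame_subset] by simp
    qed
    also have "\<dots> = (\<Sum>e\<in>E. \<Sum>w\<in>W. (p (S e v) w)\<^sup>2)" by (rule sum.swap)
    also have "\<dots> = (\<Sum>e\<in>E. p (S e v) (S e v))"
      using W.parseval[OF S_in[OF U.frame_subset assms(2)]] by (simp add: power2_eq_square)
    finally show ?thesis .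
  qed
  have 3: "(\<Sum>w\<in>W. (p w v)\<^sup>2) = p v v"
    using W.parseval[OF assms(2), of v] by (simp add: power2_eq_square W.symmetric)
  have u: "(\<Sum>e\<in>E. ip (M.curvature D (0, e, 0) (s, X, v) (s, X, v)) (0, e, 0)) =
      1/4 * q X X - 2 * (\<Sum>e\<in>E. p (A e v) (S e v)) - (\<Sum>e\<in>E. p (S e v) (S e v))"
    using sectional_u[OF assms] killing[OF assms(1) assms(1)]
    by (simp add: sum_subtractf sum_distrib_left flip: sum_divide_distrib)
  have V: "(\<Sum>w\<in>W. ip (M.curvature D (0, 0, w) (s, X, v) (s, X, v)) (0, 0, w)) =
      - \<zeta> * card W * p v v + \<zeta> * p v v + (\<Sum>e\<in>E. p (S e v) (S e v))
      - card W * s\<^sup>2 - (\<Sum>w\<in>W. p (S X w) (S X w))"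
  proof -
    have "(\<Sum>w\<in>W. ip (M.curvature D (0, 0, w) (s, X, v) (s, X, v)) (0, 0, w)) =
      (\<Sum>w\<in>W. - \<zeta> * p v v - q (\<Phi> v v) (\<Phi> w w) + \<zeta> * (p w v)\<^sup>2 + q (\<Phi> w v) (\<Phi> w v)
        - s\<^sup>2 - 2 * s * p (S X w) w - p (S X w) (S X w) - 2 * p (S X w) (A X w))"
      by (rule sum.cong[OF refl sectional_V[OF assms]])
    also have "\<dots> = - \<zeta> * card W * p v v - (\<Sum>w\<in>W. q (\<Phi> v v) (\<Phi> w w)) + \<zeta> * (\<Sum>w\<in>W. (p w v)\<^sup>2)
        + (\<Sum>w\<in>W. q (\<Phi> w v) (\<Phi> w v)) - card W * s\<^sup>2 - 2 * s * (\<Sum>w\<in>W. p (S X w) w)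
        - (\<Sum>w\<in>W. p (S X w) (S X w)) - 2 * (\<Sum>w\<in>W. p (S X w) (A X w))"
      by (simp add: sum_subtractf sum.distrib sum_distrib_left)
    finally show ?thesis
      unfolding 1 2 3 trace_S[OF assms(1)] trace_SA[OF assms(1)] by simp
  qed
  show ?thesis
    unfolding ricci_sum[OF mem mem] sum_F u V sectional_Z[OF assms] by simp
qed

text \<open>
  The Ricci operator is recovered from the Ricci form through its coordinates in the frame.
\<close>
lemma negative_ricciI:
  assumes "\<And>P. P \<in> g \<Longrightarrow> P \<noteq> 0 \<Longrightarrow> M.ricci D P P < 0"
  shows "M.negative_ricci"
proof -
  let ?r = "\<lambda>P Q. \<Sum>b\<in>F. ip (M.curvature D b P Q) b"
  have lin: "bilinear ?r"
    by (rule bilinearI)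
      (simp_all add: bilinear_simps[OF curvature_linear(1)] bilinear_simps[OF curvature_linear(2)]
        bilinear_simps[OF bilinear_ip] sum.distrib sum_distrib_left)
  define Ric where "Ric P = (\<Sum>b\<in>F. ?r P b *\<^sub>R b)" for P
  have in_g: "Ric P \<in> g" for P unfolding Ric_def by (rule G.sum_in_T)
  have ip: "ip (Ric P) Q = M.ricci D P Q" if "P \<in> g" "Q \<in> g" for P Q
  proof -
    have "ip (Ric P) Q = (\<Sum>b\<in>F. ip Q b * ?r P b)"
      unfolding Ric_def
      by (simp add: bilinear_sum_left[OF bilinear_ip] bilinear_simps[OF bilinear_ip] G.symmetric[of Q] mult.commute)
    also have "\<dots> = ?r P (\<Sum>b\<in>F. ip Q b *\<^sub>R b)"
      by (simp only: bilinear_sum_right[OF lin] bilinear_rmul[OF lin] real_scaleR_def)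
    finally show ?thesis
      using G.expansion[OF that(2)] ricci_sum[OF that] by simp
  qed
  have "real_linear_on g g Ric"
    unfolding linear_on_def using in_g
    by (auto simp: Ric_def bilinear_ladd[OF lin] bilinear_lmul[OF lin] sum.distrib scaleR_left_distrib
        scaleR_sum_right)
  then show ?thesis
    unfolding M.negative_ricci_def using levi_civita_D ip assms by metis
qed

end

context semidirect_data
begin

text \<open>
  The hypothesis \<open>big\<close> is \<open>q X X / 4 < tr (S X)\<^sup>2\<close> written with matrix entries; it does not mention the
  length of \<open>Z\<close>, which is therefore chosen last, to absorb the indefinite terms in \<open>v\<close>.
\<close>
lemma admits_negative_ricci:
  assumes "W \<noteq> {}"
    and big: "\<And>X. X \<in> u \<Longrightarrow> X \<noteq> 0 \<Longrightarrow>
      q X X < (\<Sum>w\<in>W. \<Sum>x\<in>W. (p (\<pi> X w) x + p w (\<pi> X x))\<^sup>2)"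
  shows "admits_negative_ricci (semidirect_carrier u V) (semidirect_bracket br \<pi>)"
proof -
  have lin: "bilinear (\<lambda>v w. - 2 * (\<Sum>e\<in>E. p (A e v) (S e w)))"
    by (rule bilinearI) (simp_all add: A_lin S_lin p_lin sum.distrib sum_distrib_left algebra_simps)
  obtain C where C: "C \<ge> 0" "\<And>v. v \<in> V \<Longrightarrow> - 2 * (\<Sum>e\<in>E. p (A e v) (S e v)) \<le> C * p v v"
    by (rule W.quadratic_form_bounded[OF lin]) (rule that)
  interpret semidirect_metric q E u br p W V \<pi> "C + 1"
    by unfold_locales (use C in simp)
  have N: "card W \<ge> 1"
    using \<open>W \<noteq> {}\<close> W.finite_frame by (simp add: Suc_leI card_gt_0_iff)
  have "M.ricci D P P < 0" if "P \<in> g" "P \<noteq> 0" for P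
  proof -
    obtain s X v where P: "P = (s, X, v)" by (cases P)
    have mem: "X \<in> u" "v \<in> V" using that P by (auto simp: mem_g)
    have v: "- (C + 1) * card W * p v v - 2 * (\<Sum>e\<in>E. p (A e v) (S e v)) \<le> - p v v"
    proof -
      have "(C + 1) * p v v \<le> (C + 1) * card W * p v v"
        using N C W.nonneg[OF mem(2)] by (intro mult_right_mono) auto
      then show ?thesis using C(2)[OF mem(2)] by (simp add: algebra_simps)
    qed
    have X: "1/4 * q X X - (\<Sum>w\<in>W. p (S X w) (S X w)) \<le> 0"
      "X \<noteq> 0 \<Longrightarrow> 1/4 * q X X - (\<Sum>w\<in>W. p (S X w) (S X w)) < 0"
      using big[OF mem(1)] norm_S[OF mem(1)] by (cases "X = 0"; simp add: q_lin S_lin p_lin)+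
    have s: "card W * s\<^sup>2 \<ge> 0" "s \<noteq> 0 \<Longrightarrow> card W * s\<^sup>2 > 0" using N by auto
    have "M.ricci D P P \<le> - p v v + (1/4 * q X X - (\<Sum>w\<in>W. p (S X w) (S X w))) - card W * s\<^sup>2"
      unfolding P ricci_diagonal[OF mem] using v by simp
    then show ?thesis
      using X s W.nonneg[OF mem(2)] W.positive[OF mem(2)] that(2) unfolding P
      by (cases "X = 0"; cases "v = 0"; cases "s = 0") (auto simp: zero_prod_def)
  qed
  then have "M.negative_ricci" by (rule negative_ricciI)
  then show ?thesis
    unfolding admits_negative_ricci_def using metric_lie by blast
qed

end

section \<open>Distorting an invariant inner product\<close>

text \<open>
  Two distinct powers of \<open>t\<close> have a ratio of at least \<open>t\<close> or at most \<open>1 / t\<close>.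
\<close>
lemma square_gap:
  fixes t :: real
  assumes "t \<ge> 1" "x \<noteq> (y::nat)"
  shows "(t - 1)\<^sup>2 \<le> (t ^ x / t ^ y - t ^ y / t ^ x)\<^sup>2"
proof -
  have *: "(t - 1)\<^sup>2 \<le> (t ^ x / t ^ y - t ^ y / t ^ x)\<^sup>2" if "y < x" for x y
  proof -
    have "t ^ x / t ^ y = t ^ (x - y)" "t ^ y / t ^ x = inverse (t ^ (x - y))"
      using that assms(1) by (auto simp: power_diff divide_inverse)
    moreover have "t \<le> t ^ (x - y)"
      using that assms(1) power_increasing[of 1 "x - y" t] by simp
    moreover have "inverse (t ^ (x - y)) \<le> 1"
      using assms(1) by (simp add: inverse_le_1_iff one_le_power)
    ultimately show ?thesis
      using assms(1) by (intro power_mono) auto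
  qed
  show ?thesis
    using *[of y x] *[of x y] assms(2) by (metis linorder_neqE_nat power2_commute)
qed

context compact_lie
begin

text \<open>
  With respect to the rescaled frame the matrix entry \<open>m x y\<close> of \<open>\<pi> X\<close> becomes
  \<open>(d x / d y) m x y\<close>.  As \<open>m\<close> is skew, the symmetric part has entries
  \<open>(d x / d y - d y / d x) m x y / 2\<close>, which grow with the distortion.
\<close>
lemma admits_negative_ricci_of_skew_faithful:
  fixes r :: "'v::real_vector \<Rightarrow> 'v \<Rightarrow> real"
  assumes frame: "orthonormal_frame r B V" and "B \<noteq> {}"
    and rep: "bilinear \<pi>" "\<And>X v. X \<in> u \<Longrightarrow> v \<in> V \<Longrightarrow> \<pi> X v \<in> V"
      "\<And>X Y v. X \<in> u \<Longrightarrow> Y \<in> u \<Longrightarrow> v \<in> V \<Longrightarrow> \<pi> (br X Y) v = \<pi> X (\<pi> Y v) - \<pi> Y (\<pi> X v)"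
    and skew: "\<And>X v w. v \<in> V \<Longrightarrow> w \<in> V \<Longrightarrow> r (\<pi> X v) w = - r v (\<pi> X w)"
    and faithful: "\<And>X. X \<in> u \<Longrightarrow> \<forall>v\<in>V. \<pi> X v = 0 \<Longrightarrow> X = 0"
  shows "admits_negative_ricci (semidirect_carrier u V) (semidirect_bracket br \<pi>)"
proof -
  interpret R: orthonormal_frame r B V by (rule frame)
  note r_lin = bilinear_simps[OF R.bil]
  note rep_lin = bilinear_simps[OF rep(1)]
  define m where "m X x y = r (\<pi> X y) x" for X x y
  have m_skew: "m X x y = - m X y x" if "x \<in> B" "y \<in> B" for X x y
    using skew[of y x X] that R.frame_subset R.symmetric[of y "\<pi> X x"] by (simp add: m_def)
  have m_lin: "m (X + Y) x y = m X x y + m Y x y" "m (c *\<^sub>R X) x y = c * m X x y" for X Y c x y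
    by (simp_all add: m_def rep_lin r_lin)

  (* G X X is the squared Frobenius norm of the action of X; it is definite by faithfulness. *)
  define G where "G X Y = (\<Sum>x\<in>B. \<Sum>y\<in>B. m X x y * m Y x y)" for X Y
  have "bilinear G"
    by (rule bilinearI) (simp_all add: G_def m_lin sum.distrib sum_distrib_left algebra_simps)
  moreover have "G X Y = G Y X" for X Y
    by (simp add: G_def mult.commute)
  moreover have G_pos: "G X X > 0" if X: "X \<in> u" "X \<noteq> 0" for X
  proof -
    have "G X X \<ge> 0" by (simp add: G_def sum_nonneg)
    moreover have "G X X \<noteq> 0"
    proof
      assume "G X X = 0"
      then have m0: "m X x y = 0" if "x \<in> B" "y \<in> B" for x y
        using that R.finite_frame unfolding G_def
        by (subst (asm) sum_nonneg_eq_0_iff) (auto simp: sum_nonneg sum_nonneg_eq_0_iff)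
      have "\<pi> X y = 0" if y: "y \<in> B" for y
        by (rule R.frame_eqI)
          (use rep(2)[OF X(1)] R.frame_subset[OF y] m0 y subspace_0[OF R.subspace_T] in \<open>auto simp: m_def r_lin\<close>)
      then have "\<pi> X (\<Sum>y\<in>B. r v y *\<^sub>R y) = 0" for v
        by (simp add: bilinear_sum_right[OF rep(1)] rep_lin)
      then have "\<forall>v\<in>V. \<pi> X v = 0" using R.expansion by metis
      then show False using faithful X by blast
    qed
    ultimately show ?thesis by simp
  qed
  moreover have "finite E" "span E = u" by (rule U.finite_frame, rule U.span_frame)
  ultimately obtain E' where "orthonormal_frame G E' u"
    using gram_schmidt[of G E] by metis
  then interpret G: orthonormal_frame G E' u .
  obtain C where C: "C \<ge> 0" "\<And>X. X \<in> u \<Longrightarrow> q X X \<le> C * G X X"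
    by (rule G.quadratic_form_bounded[OF U.bil]) (rule that)

  obtain idx :: "'v \<Rightarrow> nat" where idx: "inj_on idx B"
    using finite_imp_inj_to_nat_seg[OF R.finite_frame] by blast
  (* With t = C + 2 the gap (t - 1)^2 is at least C + 1, enough for strict domination of q. *)
  define t where "t = C + 2"
  define d where "d x = t ^ idx x" for x
  have t: "t \<ge> 1" using C by (simp add: t_def)
  then have d_pos: "d x > 0" for x by (simp add: d_def)
  define p where "p v w = (\<Sum>x\<in>B. (d x)\<^sup>2 * r v x * r w x)" for v w
  define W where "W = (\<lambda>x. (1 / d x) *\<^sub>R x) ` B"
  have p_bil: "bilinear p"
    by (rule bilinearI) (simp_all add: p_def r_lin sum.distrib sum_distrib_left algebra_simps)
  have p_sym: "p v w = p w v" for v w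
    by (simp add: p_def mult.commute mult.left_commute)
  have p_frame: "p v x = (d x)\<^sup>2 * r v x" if "x \<in> B" for v x
  proof -
    have "p v x = (\<Sum>z\<in>B. if z = x then (d x)\<^sup>2 * r v x else 0)"
      unfolding p_def using that by (intro sum.cong) (auto simp: R.orthonormal)
    then show ?thesis using that R.finite_frame by simp
  qed
  have inj: "inj_on (\<lambda>x. (1 / d x) *\<^sub>R x) B"
  proof
    fix x y assume xy: "x \<in> B" "y \<in> B" "(1 / d x) *\<^sub>R x = (1 / d y) *\<^sub>R y"
    then have "r ((1 / d x) *\<^sub>R x) x = r ((1 / d y) *\<^sub>R y) x" by simp
    then show "x = y"
      using R.orthonormal[OF xy(1,1)] R.orthonormal[OF xy(2,1)] d_pos[of x]
      by (auto simp: r_lin split: if_splits)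
  qed
  have W_frame: "orthonormal_frame p W V"
  proof unfold_locales
    show "bilinear p" by (rule p_bil)
    show "p x y = p y x" for x y by (rule p_sym)
    show "finite W" unfolding W_def using R.finite_frame by simp
    show "span W = V"
    proof
      show "span W \<subseteq> V"
        unfolding W_def using R.frame_subset R.subspace_T
        by (intro span_minimal) (auto intro: subspace_scale)
      have "x \<in> span W" if "x \<in> B" for x
      proof -
        have "d x *\<^sub>R ((1 / d x) *\<^sub>R x) \<in> span W"
          by (rule span_scale, rule span_base) (use that in \<open>simp add: W_def\<close>)
        then show ?thesis using d_pos[of x] by simp
      qed
      then show "V \<subseteq> span W" using R.span_frame by (metis span_minimal subsetI subspace_span)
    qed
    fix w w' assume "w \<in> W" "w' \<in> W"
    then obtain x y where xy: "x \<in> B" "y \<in> B" "w = (1 / d x) *\<^sub>R x" "w' = (1 / d y) *\<^sub>R y"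
      by (auto simp: W_def)
    have "p w w' = (if x = y then 1 else 0)"
      unfolding xy(3,4) using d_pos[of x] xy(1,2)
      by (cases "x = y")
        (auto simp: bilinear_lmul[OF p_bil] bilinear_rmul[OF p_bil] p_frame R.orthonormal power2_eq_square)
    then show "p w w' = (if w = w' then 1 else 0)"
      using inj xy by (auto simp: inj_on_def)
  qed
  have p_rep: "p (\<pi> X ((1 / d y) *\<^sub>R y)) ((1 / d x) *\<^sub>R x) = d x / d y * m X x y"
    if "x \<in> B" "y \<in> B" for X x y
    using d_pos[of x] d_pos[of y] that
    by (simp add: rep_lin bilinear_lmul[OF p_bil] bilinear_rmul[OF p_bil] p_frame m_def power2_eq_square)
  interpret semidirect_data q E u br p W V \<pi>
  proof (rule semidirect_data.intro[OF compact_lie_axioms W_frame], unfold_locales)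
    show "(\<Sum>w\<in>W. p (\<pi> X w) w) = 0" for X
      unfolding W_def sum.reindex[OF inj] comp_def
    proof (intro sum.neutral ballI)
      fix x assume x: "x \<in> B"
      have "m X x x = 0" using m_skew[OF x x, of X] by simp
      then show "p (\<pi> X ((1 / d x) *\<^sub>R x)) ((1 / d x) *\<^sub>R x) = 0"
        unfolding p_rep[OF x x] by simp
    qed
    show "bilinear \<pi>" by (rule rep(1))
    show "\<pi> X v \<in> V" if "X \<in> u" "v \<in> V" for X v by (rule rep(2)[OF that])
    show "\<pi> (br X Y) v = \<pi> X (\<pi> Y v) - \<pi> Y (\<pi> X v)" if "X \<in> u" "Y \<in> u" "v \<in> V" for X Y v
      by (rule rep(3)[OF that])
  qed
  show ?thesis
  proof (rule admits_negative_ricci)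
    show "W \<noteq> {}" using \<open>B \<noteq> {}\<close> by (simp add: W_def)
    fix X assume X: "X \<in> u" "X \<noteq> 0"
    have "q X X < (C + 1) * G X X"
      using C(2)[OF X(1)] G_pos[OF X] by (simp add: algebra_simps)
    also have "\<dots> \<le> (t - 1)\<^sup>2 * G X X"
      using C(1) G_pos[OF X] by (intro mult_right_mono) (auto simp: t_def power2_eq_square algebra_simps)
    also have "\<dots> = (\<Sum>y\<in>B. \<Sum>x\<in>B. (t - 1)\<^sup>2 * (m X x y)\<^sup>2)"
      unfolding G_def by (subst sum.swap) (simp add: sum_distrib_left power2_eq_square)
    also have "\<dots> \<le> (\<Sum>y\<in>B. \<Sum>x\<in>B. (d x / d y - d y / d x)\<^sup>2 * (m X x y)\<^sup>2)"
    proof (intro sum_mono)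
      fix x y assume xy: "y \<in> B" "x \<in> B"
      show "(t - 1)\<^sup>2 * (m X x y)\<^sup>2 \<le> (d x / d y - d y / d x)\<^sup>2 * (m X x y)\<^sup>2"
      proof (cases "x = y")
        case True
        then show ?thesis using m_skew[OF xy(1,1), of X] by simp
      next
        case False
        then have "idx x \<noteq> idx y" using idx xy by (auto simp: inj_on_def)
        then show ?thesis
          unfolding d_def by (intro mult_right_mono square_gap[OF t]) auto
      qed
    qed
    also have "\<dots> = (\<Sum>w\<in>W. \<Sum>x\<in>W. (p (\<pi> X w) x + p w (\<pi> X x))\<^sup>2)"
      unfolding W_def sum.reindex[OF inj] comp_def
    proof (intro sum.cong refl)
      fix x y assume xy: "y \<in> B" "x \<in> B"
      have "p ((1 / d y) *\<^sub>R y) (\<pi> X ((1 / d x) *\<^sub>R x)) = - (d y / d x * m X x y)"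
        using p_rep[OF xy, of X] p_sym m_skew[OF xy, of X] by simp
      then have "p (\<pi> X ((1 / d y) *\<^sub>R y)) ((1 / d x) *\<^sub>R x) + p ((1 / d y) *\<^sub>R y) (\<pi> X ((1 / d x) *\<^sub>R x))
          = (d x / d y - d y / d x) * m X x y"
        unfolding p_rep[OF xy(2,1)] by (simp add: algebra_simps)
      then show "(d x / d y - d y / d x)\<^sup>2 * (m X x y)\<^sup>2 =
        (p (\<pi> X ((1 / d y) *\<^sub>R y)) ((1 / d x) *\<^sub>R x) + p ((1 / d y) *\<^sub>R y) (\<pi> X ((1 / d x) *\<^sub>R x)))\<^sup>2"
        by (simp add: power_mult_distrib)
    qed
    finally show "q X X < (\<Sum>w\<in>W. \<Sum>x\<in>W. (p (\<pi> X w) x + p w (\<pi> X x))\<^sup>2)" .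
  qed
qed

end

section \<open>Skew operators on coordinate spaces\<close>

text \<open>
  Finite-dimensional coordinate spaces are realised as the sequences supported on a finite index set,
  so that index sets can be combined by pairing without changing the type.
\<close>
definition supported :: "nat set \<Rightarrow> cvec set"
  where "supported N = {f. \<forall>i. i \<notin> N \<longrightarrow> f i = 0}"

definition mat_apply :: "nat set \<Rightarrow> (nat \<Rightarrow> nat \<Rightarrow> complex) \<Rightarrow> cvec \<Rightarrow> cvec"
  where "mat_apply N M f = (\<lambda>i. \<Sum>j\<in>N. M i j * f j)"

text \<open>
  The real part of the standard Hermitian product: a real inner product for which multiplication by
  \<open>\<i>\<close> is skew.  Orthogonality to a complex subspace means the same for it as for the Hermitian
  product, so real orthonormal frames suffice throughout.
\<close>
definition hermitian_re :: "nat set \<Rightarrow> cvec \<Rightarrow> cvec \<Rightarrow> real"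
  where "hermitian_re N f g = Re (\<Sum>i\<in>N. f i * cnj (g i))"

definition unit_vec :: "nat \<Rightarrow> cvec"
  where "unit_vec j = (\<lambda>i. if i = j then 1 else 0)"

lemma fun_sum_apply: "(\<Sum>j\<in>A. F j) i = (\<Sum>j\<in>A. F j i)" for F :: "'j \<Rightarrow> 'x \<Rightarrow> 'y::comm_monoid_add"
  by (induction A rule: infinite_finite_induct) auto

lemma subspace_supported: "cvec.subspace (supported N)"
  by (auto simp: cvec.subspace_def supported_def cscale_def)

lemma supported_unit_vec:
  assumes "finite N" "f \<in> supported N"
  shows "f = (\<Sum>j\<in>N. cscale (f j) (unit_vec j))"
proof
  fix i
  have "(\<Sum>j\<in>N. cscale (f j) (unit_vec j)) i = (\<Sum>j\<in>N. if i = j then f j else 0)"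
    by (auto simp: fun_sum_apply cscale_def unit_vec_def intro!: sum.cong)
  then show "f i = (\<Sum>j\<in>N. cscale (f j) (unit_vec j)) i"
    using assms by (auto simp: supported_def)
qed

lemma supported_subset_span: "finite N \<Longrightarrow> supported N \<subseteq> cvec.span (unit_vec ` N)"
  using supported_unit_vec
  by (metis (no_types, lifting) cvec.span_base cvec.span_scale cvec.span_sum imageI subsetI)

lemma real_span_supported:
  assumes "finite N"
  shows "supported N \<subseteq> span (unit_vec ` N \<union> cscale \<i> ` unit_vec ` N)"
proof
  fix f assume "f \<in> supported N"
  then have "f = (\<Sum>j\<in>N. cscale (f j) (unit_vec j))" by (rule supported_unit_vec[OF assms])
  also have "\<dots> = (\<Sum>j\<in>N. Re (f j) *\<^sub>R unit_vec j + Im (f j) *\<^sub>R cscale \<i> (unit_vec j))"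
    by (intro sum.cong refl ext) (simp add: cscale_def scaleR_fun_def complex_eq_iff)
  also have "\<dots> \<in> span (unit_vec ` N \<union> cscale \<i> ` unit_vec ` N)"
    by (intro span_sum span_add span_scale span_base) auto
  finally show "f \<in> span (unit_vec ` N \<union> cscale \<i> ` unit_vec ` N)" .
qed

lemma cscale_of_real: "cscale (of_real c) f = c *\<^sub>R f"
  by (auto simp: cscale_def scaleR_fun_def scaleR_conv_of_real)

lemma complex_subspace_real: "cvec.subspace S \<Longrightarrow> subspace S"
  unfolding cvec.subspace_def subspace_def by (metis cscale_of_real)

lemma bilinear_hermitian_re: "bilinear (hermitian_re N)"
  by (rule bilinearI)
    (auto simp: hermitian_re_def scaleR_fun_def sum.distrib sum_distrib_left algebra_simps)

lemma hermitian_re_sym: "hermitian_re N f g = hermitian_re N g f"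
  by (simp add: hermitian_re_def mult.commute)

lemma hermitian_re_pos:
  assumes "finite N" "f \<in> supported N" "f \<noteq> 0"
  shows "hermitian_re N f f > 0"
proof -
  obtain i where i: "f i \<noteq> 0" using assms(3) by (auto simp: fun_eq_iff)
  then have "i \<in> N" using assms(2) by (auto simp: supported_def)
  moreover have "hermitian_re N f f = (\<Sum>i\<in>N. (cmod (f i))\<^sup>2)"
    unfolding cmod_power2 hermitian_re_def by (simp add: power2_eq_square)
  ultimately show ?thesis
    using assms(1) i by (auto intro!: sum_pos2[of N i])
qed

lemma hermitian_re_cscale: "hermitian_re N (cscale c f) g = hermitian_re N f (cscale (cnj c) g)"
  by (simp add: hermitian_re_def cscale_def mult.assoc mult.left_commute)

lemma mat_apply_linear: "Vector_Spaces.linear cscale cscale (mat_apply N M)"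
  by unfold_locales
    (auto simp: mat_apply_def cscale_def fun_eq_iff sum.distrib sum_distrib_left algebra_simps)

lemma exists_real_frame:
  assumes N: "finite N" and S: "subspace S" "S \<subseteq> supported N"
  obtains B where "orthonormal_frame (hermitian_re N) B S"
proof -
  obtain B where B: "B \<subseteq> S" "independent B" "S \<subseteq> span B" by (rule maximal_independent_subset)
  have "finite (unit_vec ` N \<union> cscale \<i> ` unit_vec ` N)" using N by simp
  then have "finite B"
    using independent_span_bound[OF _ B(2)] B(1) S(2) real_span_supported[OF N] by blast
  moreover have "span B = S" using B S by (simp add: span_minimal subset_antisym)
  ultimately show ?thesis
    using gram_schmidt[of "hermitian_re N" B] bilinear_hermitian_re hermitian_re_sym
      hermitian_re_pos[OF N] S(2) that by (metis subsetD)
qed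

text \<open>
  The vector \<open>p(T) v\<close>.
\<close>
definition krylov :: "(cvec \<Rightarrow> cvec) \<Rightarrow> cvec \<Rightarrow> complex poly \<Rightarrow> cvec"
  where "krylov T v p = (\<Sum>n\<le>degree p. cscale (coeff p n) ((T ^^ n) v))"

lemma krylov_bound: "degree p \<le> K \<Longrightarrow> krylov T v p = (\<Sum>n\<le>K. cscale (coeff p n) ((T ^^ n) v))"
  unfolding krylov_def
  by (rule sum.mono_neutral_left) (auto simp: coeff_eq_0)

lemma krylov_root_factor:
  assumes "Vector_Spaces.linear cscale cscale T"
  shows "krylov T v ([:-z, 1:] * g) = T (krylov T v g) - cscale z (krylov T v g)"
proof -
  interpret T: Vector_Spaces.linear cscale cscale T by fact
  define K where "K = degree g"
  have "degree ([:-z, 1:] * g) \<le> Suc K"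
    unfolding K_def by (rule order.trans[OF degree_mult_le]) simp
  then have "krylov T v ([:-z, 1:] * g) =
      (\<Sum>n\<le>Suc K. cscale (coeff (pCons 0 g) n) ((T ^^ n) v) - cscale (z * coeff g n) ((T ^^ n) v))"
    by (subst krylov_bound, assumption)
      (simp add: cvec.scale_left_diff_distrib algebra_simps)
  also have "\<dots> = (\<Sum>n\<le>Suc K. cscale (coeff (pCons 0 g) n) ((T ^^ n) v))
      - (\<Sum>n\<le>Suc K. cscale (z * coeff g n) ((T ^^ n) v))"
    by (rule sum_subtractf)
  also have "(\<Sum>n\<le>Suc K. cscale (coeff (pCons 0 g) n) ((T ^^ n) v)) = T (krylov T v g)"
    by (subst sum.atMost_Suc_shift) (simp add: krylov_def K_def T.sum T.scale)
  also have "(\<Sum>n\<le>Suc K. cscale (z * coeff g n) ((T ^^ n) v)) = cscale z (krylov T v g)"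
    by (subst krylov_bound[of g "Suc K"]) (simp_all add: K_def cvec.scale_sum_right del: sum.atMost_Suc)
  finally show ?thesis .
qed

lemma exists_annihilating_poly:
  assumes N: "finite N" and T: "\<And>f. f \<in> supported N \<Longrightarrow> T f \<in> supported N" and v: "v \<in> supported N"
  obtains p where "p \<noteq> 0" "krylov T v p = 0"
proof -
  define w where "w n = (T ^^ n) v" for n
  have w: "w n \<in> supported N" for n
    unfolding w_def using v T by (induction n) auto
  define K where "K = card (unit_vec ` N)"
  have "\<exists>a. (\<exists>n\<le>K. a n \<noteq> 0) \<and> (\<Sum>n\<le>K. cscale (a n) (w n)) = 0"
  proof (cases "inj_on w {..K}")
    case True
    then have "card (w ` {..K}) = Suc K" by (simp add: card_image)
    then have "cvec.dependent (w ` {..K})"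
      using cvec.independent_span_bound[of "unit_vec ` N" "w ` {..K}"] N w
        supported_subset_span[OF N] K_def by auto
    then obtain b where b: "\<exists>x\<in>w ` {..K}. b x \<noteq> 0" "(\<Sum>x\<in>w ` {..K}. cscale (b x) x) = 0"
      by (subst (asm) cvec.dependent_finite) auto
    then have "(\<Sum>n\<le>K. cscale (b (w n)) (w n)) = 0"
      using True by (simp add: sum.reindex)
    then show ?thesis using b(1) by (intro exI[of _ "\<lambda>n. b (w n)"]) auto
  next
    case False
    then obtain i j where ij: "i \<le> K" "j \<le> K" "i \<noteq> j" "w i = w j" by (auto simp: inj_on_def)
    let ?a = "\<lambda>n. (if n = i then 1 else 0) - (if n = j then 1 else 0) :: complex"
    have "(\<Sum>n\<le>K. cscale (?a n) (w n)) = (\<Sum>n\<le>K. (if n = i then w n else 0) - (if n = j then w n else 0))"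
      by (intro sum.cong) (auto simp: cscale_def fun_eq_iff)
    also have "\<dots> = 0" using ij by (simp add: sum_subtractf)
    finally show ?thesis using ij by (intro exI[of _ ?a]) auto
  qed
  then obtain a where a: "\<exists>n\<le>K. a n \<noteq> 0" "(\<Sum>n\<le>K. cscale (a n) (w n)) = 0" by blast
  define p where "p = (\<Sum>n\<le>K. monom (a n) n)"
  have coeff: "coeff p n = (if n \<le> K then a n else 0)" for n
    unfolding p_def by (auto simp: coeff_sum coeff_monom)
  have "degree p \<le> K" by (rule degree_le) (simp add: coeff)
  then have "krylov T v p = 0"
    using a(2) by (simp add: krylov_bound coeff w_def)
  moreover have "p \<noteq> 0" using a(1) coeff by (metis coeff_0)
  ultimately show ?thesis using that by blast
qed

text \<open>
  For \<open>w\<close> in the range of \<open>T\<close>, let \<open>p\<close> be a polynomial of least degree with \<open>p(T) w = 0\<close>.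
  If \<open>p = (x - z) g\<close>, then \<open>g(T) w\<close> is an eigenvector for \<open>z\<close>.  It lies in the range of \<open>T\<close>,
  which meets the kernel only in \<open>0\<close> because \<open>T\<close> is skew; hence \<open>z \<noteq> 0\<close>.
\<close>
lemma exists_nonzero_eigenvalue:
  assumes N: "finite N" and lin: "Vector_Spaces.linear cscale cscale T"
    and T: "\<And>f. f \<in> supported N \<Longrightarrow> T f \<in> supported N"
    and skew: "\<And>f g. f \<in> supported N \<Longrightarrow> g \<in> supported N \<Longrightarrow>
      hermitian_re N (T f) g = - hermitian_re N f (T g)"
    and f: "f \<in> supported N" "T f \<noteq> 0"
  obtains c e where "c \<noteq> 0" "e \<in> supported N" "e \<noteq> 0" "T e = cscale c e"
proof -
  interpret T: Vector_Spaces.linear cscale cscale T by fact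
  note h_lin = bilinear_simps[OF bilinear_hermitian_re]
  obtain p0 where p0: "p0 \<noteq> 0" "krylov T (T f) p0 = 0"
    by (rule exists_annihilating_poly[of N T "T f"]) (use N T f in auto)
  obtain p where p: "p \<noteq> 0" "krylov T (T f) p = 0"
    and min: "\<And>g. g \<noteq> 0 \<Longrightarrow> krylov T (T f) g = 0 \<Longrightarrow> degree p \<le> degree g"
    using ex_has_least_nat[of "\<lambda>p. p \<noteq> 0 \<and> krylov T (T f) p = 0" p0 degree] p0 by auto
  have "degree p \<noteq> 0"
  proof
    assume "degree p = 0"
    then obtain a where "p = [:a:]" by (rule degree_eq_zeroE)
    then show False using p f by (auto simp: krylov_def cvec.scale_eq_0_iff)
  qed
  then have "\<not> constant (poly p)" by (simp add: constant_degree)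
  then obtain z where "poly p z = 0" using fundamental_theorem_of_algebra by blast
  then obtain g where g: "p = [:-z, 1:] * g" by (auto simp: poly_eq_0_iff_dvd dvd_def)
  have "g \<noteq> 0" using g p(1) by auto
  then have "degree g < degree p" unfolding g by (subst degree_mult_eq) auto
  define e where "e = krylov T (T f) g"
  have e0: "e \<noteq> 0" unfolding e_def using min[of g] \<open>g \<noteq> 0\<close> \<open>degree g < degree p\<close> by auto
  have Te: "T e = cscale z e"
    using p(2) unfolding g krylov_root_factor[OF lin] e_def by simp
  have pow: "(T ^^ n) (T f) = T ((T ^^ n) f)" for n by (simp add: funpow_swap1)
  define e' where "e' = krylov T f g"
  have pow_in: "(T ^^ n) f \<in> supported N" for n using f(1) T by (induction n) auto
  then have e'_in: "e' \<in> supported N"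
    unfolding e'_def krylov_def
    by (intro cvec.subspace_sum[OF subspace_supported] cvec.subspace_scale[OF subspace_supported])
  have e: "e = T e'"
    unfolding e_def e'_def krylov_def by (simp add: pow T.sum T.scale)
  then have e_in: "e \<in> supported N" using T e'_in by simp
  have "z \<noteq> 0"
  proof
    assume "z = 0"
    then have "T e = 0" using Te by simp
    then have "hermitian_re N e e = 0"
      using skew[OF e'_in e_in] e by (simp add: h_lin)
    then show False using hermitian_re_pos[OF N e_in e0] by simp
  qed
  then show ?thesis using that e_in e0 Te by blast
qed

section \<open>Tensor products of matrix representations\<close>

text \<open>
  The tensor product of two coordinate spaces has coordinates indexed by encoded pairs.
\<close>
definition product_index :: "nat set \<Rightarrow> nat set \<Rightarrow> nat set"
  where "product_index N N' = prod_encode ` (N \<times> N')"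

text \<open>
  The matrix of \<open>A \<otimes> 1 + 1 \<otimes> B\<close>, the action of a Lie algebra element on a tensor product.
\<close>
definition tensor_mat ::
  "nat set \<Rightarrow> (nat \<Rightarrow> nat \<Rightarrow> complex) \<Rightarrow> nat set \<Rightarrow> (nat \<Rightarrow> nat \<Rightarrow> complex) \<Rightarrow> nat \<Rightarrow> nat \<Rightarrow> complex"
  where "tensor_mat N A N' B i j =
    (if i \<in> product_index N N' \<and> j \<in> product_index N N' then
       (if snd (prod_decode i) = snd (prod_decode j) then A (fst (prod_decode i)) (fst (prod_decode j)) else 0) +
       (if fst (prod_decode i) = fst (prod_decode j) then B (snd (prod_decode i)) (snd (prod_decode j)) else 0)
     else 0)"

definition tensor_vec :: "nat set \<Rightarrow> cvec \<Rightarrow> nat set \<Rightarrow> cvec \<Rightarrow> cvec"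
  where "tensor_vec N v N' w i =
    (if i \<in> product_index N N' then v (fst (prod_decode i)) * w (snd (prod_decode i)) else 0)"

lemma sum_product_index:
  "(\<Sum>k\<in>product_index N N'. f k) = (\<Sum>c\<in>N. \<Sum>d\<in>N'. f (prod_encode (c, d)))"
  unfolding product_index_def sum.cartesian_product
  by (subst sum.reindex[OF inj_prod_encode]) (auto intro!: sum.cong)

lemma product_index_encode: "prod_encode (a, b) \<in> product_index N N' \<longleftrightarrow> a \<in> N \<and> b \<in> N'"
  by (auto simp: product_index_def)

lemma product_index_cases:
  assumes "i \<in> product_index N N'"
  obtains a b where "i = prod_encode (a, b)" "a \<in> N" "b \<in> N'"
  using assms by (auto simp: product_index_def)

lemma tensor_mat_encode:
  "a \<in> N \<Longrightarrow> c \<in> N \<Longrightarrow> b \<in> N' \<Longrightarrow> d \<in> N' \<Longrightarrow>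
    tensor_mat N A N' B (prod_encode (a, b)) (prod_encode (c, d)) =
      (if b = d then A a c else 0) + (if a = c then B b d else 0)"
  by (simp add: tensor_mat_def product_index_encode)

text \<open>
  The two mixed terms are symmetric under exchanging the factors \<open>(A, B)\<close> and \<open>(A', B')\<close>, so they cancel in a
  commutator.
\<close>
lemma tensor_mat_product:
  assumes N: "finite N" "finite N'" and i: "a \<in> N" "b \<in> N'" and j: "c \<in> N" "d \<in> N'"
  shows "(\<Sum>k\<in>product_index N N'. tensor_mat N A N' B (prod_encode (a, b)) k * tensor_mat N A' N' B' k (prod_encode (c, d)))
    = (if b = d then \<Sum>k\<in>N. A a k * A' k c else 0) + A a c * B' b d + A' a c * B b d
      + (if a = c then \<Sum>k\<in>N'. B b k * B' k d else 0)" (is "?L = _")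
proof -
  have "?L = (\<Sum>x\<in>N. \<Sum>y\<in>N'.
      (if b = y then A a x * (if y = d then A' x c else 0) else 0)
      + (if b = y then A a x * (if x = c then B' y d else 0) else 0)
      + (if a = x then B b y * (if y = d then A' x c else 0) else 0)
      + (if a = x then B b y * (if x = c then B' y d else 0) else 0))"
    unfolding sum_product_index
  proof (intro sum.cong refl)
    fix x y assume "x \<in> N" "y \<in> N'"
    then show "tensor_mat N A N' B (prod_encode (a, b)) (prod_encode (x, y)) * tensor_mat N A' N' B' (prod_encode (x, y)) (prod_encode (c, d))
      = (if b = y then A a x * (if y = d then A' x c else 0) else 0)
      + (if b = y then A a x * (if x = c then B' y d else 0) else 0)
      + (if a = x then B b y * (if y = d then A' x c else 0) else 0)
      + (if a = x then B b y * (if x = c then B' y d else 0) else 0)"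
      unfolding tensor_mat_encode[OF i(1) \<open>x \<in> N\<close> i(2) \<open>y \<in> N'\<close>]
        tensor_mat_encode[OF \<open>x \<in> N\<close> j(1) \<open>y \<in> N'\<close> j(2)]
      by (cases "b = y"; cases "a = x") (simp_all add: algebra_simps)
  qed
  also have "\<dots> = (\<Sum>x\<in>N. A a x * (if b = d then A' x c else 0))
      + (\<Sum>x\<in>N. A a x * (if x = c then B' b d else 0))
      + (\<Sum>y\<in>N'. B b y * (if y = d then A' a c else 0))
      + (\<Sum>y\<in>N'. B b y * (if a = c then B' y d else 0))"
  proof -
    have 1: "(\<Sum>x\<in>N. \<Sum>y\<in>N'. if b = y then F x y else 0) = (\<Sum>x\<in>N. F x b)" for F :: "nat \<Rightarrow> nat \<Rightarrow> complex"
      using N i by (simp add: sum.delta)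
    have 2: "(\<Sum>x\<in>N. \<Sum>y\<in>N'. if a = x then F x y else 0) = (\<Sum>y\<in>N'. F a y)" for F :: "nat \<Rightarrow> nat \<Rightarrow> complex"
      using N i by (subst sum.swap) (simp add: sum.delta)
    show ?thesis
      unfolding sum.distrib 1 2 ..
  qed
  also have "(\<Sum>x\<in>N. A a x * (if x = c then B' b d else 0)) = A a c * B' b d"
    using N j by (simp add: if_distrib[of "\<lambda>t. _ * t"] sum.delta cong: if_cong)
  also have "(\<Sum>y\<in>N'. B b y * (if y = d then A' a c else 0)) = B b d * A' a c"
    using N j by (simp add: if_distrib[of "\<lambda>t. _ * t"] sum.delta cong: if_cong)
  finally show ?thesis by simp
qed

lemma tensor_mat_apply_vec:
  assumes N: "finite N" "finite N'"
  shows "mat_apply (product_index N N') (tensor_mat N A N' B) (tensor_vec N v N' w) =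
    tensor_vec N (mat_apply N A v) N' w + tensor_vec N v N' (mat_apply N' B w)" (is "?L = ?R")
proof
  fix i
  show "?L i = ?R i"
  proof (cases "i \<in> product_index N N'")
    case True
    then obtain a b where i: "i = prod_encode (a, b)" "a \<in> N" "b \<in> N'" by (rule product_index_cases)
    have "?L i = (\<Sum>x\<in>N. \<Sum>y\<in>N'. (if b = y then A a x * v x * w y else 0) + (if a = x then B b y * v x * w y else 0))"
      unfolding mat_apply_def sum_product_index i(1)
      using i by (intro sum.cong refl) (simp add: tensor_mat_encode tensor_vec_def product_index_encode algebra_simps)
    also have "\<dots> = (\<Sum>x\<in>N. \<Sum>y\<in>N'. if b = y then A a x * v x * w y else 0) + (\<Sum>y\<in>N'. \<Sum>x\<in>N. if a = x then B b y * v x * w y else 0)"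
      unfolding sum.distrib by (subst (2) sum.swap) simp
    also have "\<dots> = (\<Sum>x\<in>N. A a x * v x * w b) + (\<Sum>y\<in>N'. B b y * v a * w y)"
      using N i by (simp add: sum.delta)
    finally show ?thesis
      using i by (simp add: tensor_vec_def product_index_encode mat_apply_def sum_distrib_left sum_distrib_right mult_ac)
  qed (auto simp: mat_apply_def tensor_mat_def tensor_vec_def)
qed

context compact_lie
begin

text \<open>
  Skew-Hermitian matrices encode invariance of the standard Hermitian product.  As the entries vanish
  outside \<open>N\<close>, the bracket law can be required for all indices.
\<close>
definition matrix_rep :: "nat set \<Rightarrow> ('a \<Rightarrow> nat \<Rightarrow> nat \<Rightarrow> complex) \<Rightarrow> bool"
  where "matrix_rep N M \<longleftrightarrow> finite N \<and> (\<forall>i j. linear (\<lambda>X. M X i j)) \<and>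
    (\<forall>X i j. M X j i = - cnj (M X i j)) \<and> (\<forall>X i j. i \<notin> N \<longrightarrow> M X i j = 0) \<and>
    (\<forall>X Y i j. M (br X Y) i j = (\<Sum>k\<in>N. M X i k * M Y k j) - (\<Sum>k\<in>N. M Y i k * M X k j))"

lemma matrix_repD:
  assumes "matrix_rep N M"
  shows "finite N" "linear (\<lambda>X. M X i j)" "M X j i = - cnj (M X i j)" "i \<notin> N \<Longrightarrow> M X i j = 0"
    "M (br X Y) i j = (\<Sum>k\<in>N. M X i k * M Y k j) - (\<Sum>k\<in>N. M Y i k * M X k j)"
  using assms unfolding matrix_rep_def by blast+

lemma matrix_rep_skew:
  assumes "matrix_rep N M"
  shows "hermitian_re N (mat_apply N (M X) f) g = - hermitian_re N f (mat_apply N (M X) g)"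
proof -
  have skew: "M X j i = - cnj (M X i j)" for i j by (rule matrix_repD[OF assms])
  have "(\<Sum>i\<in>N. (\<Sum>j\<in>N. M X i j * f j) * cnj (g i)) = (\<Sum>j\<in>N. \<Sum>i\<in>N. M X i j * f j * cnj (g i))"
    unfolding sum_distrib_right by (rule sum.swap)
  also have "\<dots> = (\<Sum>j\<in>N. - (f j * cnj (\<Sum>i\<in>N. M X j i * g i)))"
  proof (rule sum.cong[OF refl])
    fix j assume "j \<in> N"
    have "M X i j * f j * cnj (g i) = - (f j * cnj (M X j i * g i))" for i
      using skew[of i j] by simp
    then show "(\<Sum>i\<in>N. M X i j * f j * cnj (g i)) = - (f j * cnj (\<Sum>i\<in>N. M X j i * g i))"
      by (simp add: sum_negf sum_distrib_left)
  qed
  finally show ?thesis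
    by (simp add: hermitian_re_def mat_apply_def sum_negf)
qed

lemma matrix_rep_supported: "matrix_rep N M \<Longrightarrow> mat_apply N (M X) f \<in> supported N"
  by (simp add: matrix_repD(4) supported_def mat_apply_def)

lemma matrix_rep_bracket:
  assumes "matrix_rep N M"
  shows "mat_apply N (M (br X Y)) f =
    mat_apply N (M X) (mat_apply N (M Y) f) - mat_apply N (M Y) (mat_apply N (M X) f)"
proof
  have prod: "(\<Sum>j\<in>N. (\<Sum>k\<in>N. M X i k * M Y k j) * f j) = mat_apply N (M X) (mat_apply N (M Y) f) i" for X Y i
    unfolding mat_apply_def sum_distrib_right sum_distrib_left by (subst sum.swap) (simp add: mult.assoc)
  fix i
  have "mat_apply N (M (br X Y)) f i =
      (\<Sum>j\<in>N. (\<Sum>k\<in>N. M X i k * M Y k j) * f j) - (\<Sum>j\<in>N. (\<Sum>k\<in>N. M Y i k * M X k j) * f j)"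
    by (simp add: mat_apply_def matrix_repD(5)[OF assms] left_diff_distrib sum_subtractf)
  then show "mat_apply N (M (br X Y)) f i =
      (mat_apply N (M X) (mat_apply N (M Y) f) - mat_apply N (M Y) (mat_apply N (M X) f)) i"
    unfolding prod by simp
qed

lemma matrix_rep_bilinear:
  assumes "matrix_rep N M"
  shows "bilinear (\<lambda>X f. mat_apply N (M X) f)"
proof -
  have "M (X + Y) i j = M X i j + M Y i j" "M (c *\<^sub>R X) i j = c *\<^sub>R M X i j" for X Y c i j
    using linear_add[OF matrix_repD(2)[OF assms]] linear_scale[OF matrix_repD(2)[OF assms]] .
  then show ?thesis
    by (intro bilinearI)
      (auto simp: mat_apply_def fun_eq_iff scaleR_fun_def sum.distrib scaleR_sum_right algebra_simps)
qed

text \<open>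
  A simultaneous eigenvalue system for the elements of \<open>H\<close>, in the sense of weights with respect to a
  torus.  It adds under tensor products.
\<close>
definition weight :: "nat set \<Rightarrow> ('a \<Rightarrow> nat \<Rightarrow> nat \<Rightarrow> complex) \<Rightarrow> 'a set \<Rightarrow> ('a \<Rightarrow> complex) \<Rightarrow> bool"
  where "weight N M H c \<longleftrightarrow>
    (\<exists>v\<in>supported N. v \<noteq> 0 \<and> (\<forall>X\<in>H. mat_apply N (M X) v = cscale (c X) v))"

lemma matrix_rep_tensor:
  assumes 1: "matrix_rep N M" and 2: "matrix_rep N' M'"
  shows "matrix_rep (product_index N N') (\<lambda>X. tensor_mat N (M X) N' (M' X))"
  unfolding matrix_rep_def
proof (intro conjI allI impI)
  have N: "finite N" "finite N'" by (rule matrix_repD[OF 1] matrix_repD[OF 2])+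
  then show "finite (product_index N N')" by (simp add: product_index_def)
  have lin: "linear (\<lambda>X. M X i j)" "linear (\<lambda>X. M' X i j)" for i j
    by (rule matrix_repD[OF 1] matrix_repD[OF 2])+
  show "linear (\<lambda>X. tensor_mat N (M X) N' (M' X) i j)" for i j
    unfolding tensor_mat_def
    by (rule linearI) (auto simp: linear_add[OF lin(1)] linear_add[OF lin(2)]
        linear_scale[OF lin(1)] linear_scale[OF lin(2)] scaleR_add_right)
  have skew: "M X j i = - cnj (M X i j)" "M' X j i = - cnj (M' X i j)" for X i j
    by (rule matrix_repD[OF 1] matrix_repD[OF 2])+
  show "tensor_mat N (M X) N' (M' X) j i = - cnj (tensor_mat N (M X) N' (M' X) i j)" for X i j
    unfolding tensor_mat_def
    using skew(1)[of X "fst (prod_decode j)" "fst (prod_decode i)"]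
      skew(2)[of X "snd (prod_decode j)" "snd (prod_decode i)"] by auto
  show "tensor_mat N (M X) N' (M' X) i j = 0" if "i \<notin> product_index N N'" for X i j
    using that by (simp add: tensor_mat_def)
  let ?T = "\<lambda>X. tensor_mat N (M X) N' (M' X)"
  show "?T (br X Y) i j = (\<Sum>k\<in>product_index N N'. ?T X i k * ?T Y k j) - (\<Sum>k\<in>product_index N N'. ?T Y i k * ?T X k j)"
    for X Y i j
  proof (cases "i \<in> product_index N N' \<and> j \<in> product_index N N'")
    case True
    then obtain a b c d where ij: "i = prod_encode (a, b)" "a \<in> N" "b \<in> N'"
      "j = prod_encode (c, d)" "c \<in> N" "d \<in> N'"
      by (metis product_index_cases)
    have br: "M (br X Y) a c = (\<Sum>k\<in>N. M X a k * M Y k c) - (\<Sum>k\<in>N. M Y a k * M X k c)"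
      "M' (br X Y) b d = (\<Sum>k\<in>N'. M' X b k * M' Y k d) - (\<Sum>k\<in>N'. M' Y b k * M' X k d)"
      by (rule matrix_repD[OF 1] matrix_repD[OF 2])+
    show ?thesis
      unfolding ij(1,4) tensor_mat_product[OF N ij(2,3,5,6)]
      unfolding tensor_mat_encode[OF ij(2,5,3,6)] br by simp
  qed (auto simp: tensor_mat_def)
qed

lemma weight_tensor:
  assumes rep: "matrix_rep N M" "matrix_rep N' M'"
    and w: "weight N M H c" "weight N' M' H c'"
  shows "weight (product_index N N') (\<lambda>X. tensor_mat N (M X) N' (M' X)) H (\<lambda>X. c X + c' X)"
proof -
  have N: "finite N" "finite N'" by (rule matrix_repD[OF rep(1)] matrix_repD[OF rep(2)])+
  obtain v where v: "v \<in> supported N" "v \<noteq> 0" "\<And>X. X \<in> H \<Longrightarrow> mat_apply N (M X) v = cscale (c X) v"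
    using w(1) by (auto simp: weight_def)
  obtain v' where v': "v' \<in> supported N'" "v' \<noteq> 0" "\<And>X. X \<in> H \<Longrightarrow> mat_apply N' (M' X) v' = cscale (c' X) v'"
    using w(2) by (auto simp: weight_def)
  let ?t = "tensor_vec N v N' v'"
  have "?t \<in> supported (product_index N N')" by (simp add: supported_def tensor_vec_def)
  moreover have "?t \<noteq> 0"
  proof -
    obtain a b where ab: "v a \<noteq> 0" "v' b \<noteq> 0" using v(2) v'(2) by (auto simp: fun_eq_iff)
    then have "a \<in> N" "b \<in> N'" using v(1) v'(1) by (auto simp: supported_def)
    then have "?t (prod_encode (a, b)) \<noteq> 0" using ab by (simp add: tensor_vec_def product_index_encode)
    then show ?thesis by (metis zero_fun_apply)
  qed
  moreover have "mat_apply (product_index N N') (tensor_mat N (M X) N' (M' X)) ?t = cscale (c X + c' X) ?t"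
    if "X \<in> H" for X
    unfolding tensor_mat_apply_vec[OF N] v(3)[OF that] v'(3)[OF that]
    by (auto simp: fun_eq_iff tensor_vec_def cscale_def algebra_simps)
  ultimately show ?thesis unfolding weight_def by blast
qed

lemma matrix_rep_trivial: "matrix_rep {0} (\<lambda>X i j. 0)"
  by (auto simp: matrix_rep_def linear_iff)

lemma weight_trivial: "weight {0} (\<lambda>X i j. 0) H (\<lambda>X. 0)"
  unfolding weight_def
  by (rule bexI[of _ "unit_vec 0"])
    (auto simp: unit_vec_def supported_def mat_apply_def cscale_def fun_eq_iff)

section \<open>The adjoint representation and minimal ideals\<close>
definition dim_u :: nat where "dim_u = card E"

definition basis_at :: "nat \<Rightarrow> 'a" where "basis_at = (SOME f. bij_betw f {..<dim_u} E)"

lemma basis_at: "bij_betw basis_at {..<dim_u} E"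
proof -
  have "\<exists>f. bij_betw f {..<dim_u} E"
    using ex_bij_betw_nat_finite[OF U.finite_frame] by (simp add: dim_u_def atLeast0LessThan)
  then show ?thesis unfolding basis_at_def by (rule someI_ex)
qed

lemma basis_at_mem: "i < dim_u \<Longrightarrow> basis_at i \<in> E"
  using basis_at by (auto simp: bij_betw_def)

lemma sum_basis_at: "(\<Sum>i<dim_u. f (basis_at i)) = (\<Sum>e\<in>E. f e)"
  by (rule sum.reindex_bij_betw[OF basis_at])

definition Ad :: "'a \<Rightarrow> nat \<Rightarrow> nat \<Rightarrow> complex"
  where "Ad X i j = (if i < dim_u \<and> j < dim_u then complex_of_real (q (br X (basis_at j)) (basis_at i)) else 0)"

lemma matrix_rep_Ad: "matrix_rep {..<dim_u} Ad"
  unfolding matrix_rep_def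
proof (intro conjI allI impI)
  show "linear (\<lambda>X. Ad X i j)" for i j
    by (rule linearI) (auto simp: Ad_def br_lin q_lin scaleR_conv_of_real)
  show "Ad X j i = - cnj (Ad X i j)" for X i j
    using invariant[of X "basis_at i" "basis_at j"] U.symmetric[of "basis_at i" "br X (basis_at j)"] by (auto simp: Ad_def)
  have prod: "(\<Sum>k<dim_u. Ad X i k * Ad Y k j) = of_real (q (br X (br Y (basis_at j))) (basis_at i))"
    if "i < dim_u" "j < dim_u" for X Y i j
  proof -
    have "(\<Sum>k<dim_u. Ad X i k * Ad Y k j) = of_real (\<Sum>k<dim_u. q (br X (basis_at k)) (basis_at i) * q (br Y (basis_at j)) (basis_at k))"
      using that by (simp add: Ad_def)
    also have "(\<Sum>k<dim_u. q (br X (basis_at k)) (basis_at i) * q (br Y (basis_at j)) (basis_at k))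
        = (\<Sum>e\<in>E. q (br X e) (basis_at i) * q (br Y (basis_at j)) e)"
      by (rule sum_basis_at)
    also have "\<dots> = - (\<Sum>e\<in>E. q (br Y (basis_at j)) e * q (br X (basis_at i)) e)"
      using invariant[of X _ "basis_at i"] U.symmetric[of _ "br X (basis_at i)"] by (simp add: sum_negf mult.commute)
    also have "\<dots> = q (br X (br Y (basis_at j))) (basis_at i)"
      using U.parseval[of "br Y (basis_at j)" "br X (basis_at i)"] invariant[of X "br Y (basis_at j)" "basis_at i"] br(2) by simp
    finally show ?thesis .
  qed
  show "Ad (br X Y) i j = (\<Sum>k<dim_u. Ad X i k * Ad Y k j) - (\<Sum>k<dim_u. Ad Y i k * Ad X k j)" for X Y i j
  proof (cases "i < dim_u \<and> j < dim_u")
    case True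
    then show ?thesis
      using prod[of i j X Y] prod[of i j Y X] by (simp add: Ad_def br_br q_lin)
  qed (auto simp: Ad_def)
qed (auto simp: Ad_def)

text \<open>
  A semisimple algebra has no centre.
\<close>
lemma bracket_nonzero:
  assumes "X \<in> u" "X \<noteq> 0"
  obtains e where "e \<in> E" "br X e \<noteq> 0"
proof -
  have "(\<Sum>e\<in>E. q (br e X) (br e X)) \<noteq> 0"
    using killing[of X X] U.positive[of X] assms by simp
  then obtain e where "e \<in> E" "q (br e X) (br e X) \<noteq> 0" by (meson sum.neutral)
  then have "e \<in> E" "br e X \<noteq> 0" by (auto simp: q_lin)
  then show ?thesis using that br_skew[of X e] by simp
qed

definition of_coords :: "(nat \<Rightarrow> real) \<Rightarrow> 'a" where "of_coords a = (\<Sum>i<dim_u. a i *\<^sub>R basis_at i)"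

lemma of_coords_in: "of_coords a \<in> u"
  unfolding of_coords_def using basis_at_mem U.frame_subset
  by (auto intro!: subspace_sum[OF U.subspace_T] subspace_scale[OF U.subspace_T])

lemma q_of_coords: "i < dim_u \<Longrightarrow> q (of_coords a) (basis_at i) = a i"
proof -
  assume i: "i < dim_u"
  have "q (of_coords a) (basis_at i) = (\<Sum>j<dim_u. a j * q (basis_at j) (basis_at i))"
    by (simp add: of_coords_def bilinear_sum_left[OF U.bil] q_lin)
  also have "\<dots> = (\<Sum>j<dim_u. if j = i then a j else 0)"
    using i basis_at_mem basis_at by (intro sum.cong) (auto simp: U.orthonormal bij_betw_def inj_on_def)
  finally show ?thesis using i by simp
qed

lemma basis_at_eqI:
  assumes "X \<in> u" "Y \<in> u" "\<And>i. i < dim_u \<Longrightarrow> q X (basis_at i) = q Y (basis_at i)"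
  shows "X = Y"
proof (rule U.frame_eqI[OF assms(1,2)])
  fix e assume "e \<in> E"
  then obtain i where "i < dim_u" "e = basis_at i" using basis_at unfolding bij_betw_def by blast
  then show "q X e = q Y e" using assms(3) by simp
qed

lemma Ad_apply:
  assumes "i < dim_u"
  shows "Re (mat_apply {..<dim_u} (Ad X) f i) = q (br X (of_coords (\<lambda>i. Re (f i)))) (basis_at i)"
    and "Im (mat_apply {..<dim_u} (Ad X) f i) = q (br X (of_coords (\<lambda>i. Im (f i)))) (basis_at i)"
  using assms
  by (auto simp: mat_apply_def Ad_def of_coords_def bilinear_sum_right[OF br(1)] bilinear_sum_left[OF U.bil]
      br_lin q_lin mult.commute intro!: sum.cong)

text \<open>
  An eigenvector equation over \<open>\<complex>\<close> splits into two real bracket relations in \<open>u\<close>, which makes it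
  accessible to arguments about ideals.
\<close>
lemma Ad_eigenvector_iff:
  assumes "f \<in> supported {..<dim_u}"
  shows "mat_apply {..<dim_u} (Ad X) f = cscale c f \<longleftrightarrow>
    br X (of_coords (\<lambda>i. Re (f i))) = Re c *\<^sub>R of_coords (\<lambda>i. Re (f i)) - Im c *\<^sub>R of_coords (\<lambda>i. Im (f i)) \<and>
    br X (of_coords (\<lambda>i. Im (f i))) = Re c *\<^sub>R of_coords (\<lambda>i. Im (f i)) + Im c *\<^sub>R of_coords (\<lambda>i. Re (f i))"
    (is "?L \<longleftrightarrow> br X ?a = ?a' \<and> br X ?b = ?b'")
proof -
  have in_u: "br X ?a \<in> u" "br X ?b \<in> u" "?a' \<in> u" "?b' \<in> u"
    by (auto intro!: br of_coords_in subspace_add[OF U.subspace_T] subspace_diff[OF U.subspace_T] subspace_scale[OF U.subspace_T])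
  have zero: "mat_apply {..<dim_u} (Ad X) f i = 0" "f i = 0" if "\<not> i < dim_u" for i
    using that assms by (auto simp: mat_apply_def Ad_def supported_def)
  have "?L \<longleftrightarrow> (\<forall>i<dim_u. mat_apply {..<dim_u} (Ad X) f i = c * f i)"
    unfolding fun_eq_iff cscale_def using zero by (metis mult_zero_right)
  also have "\<dots> \<longleftrightarrow> (\<forall>i<dim_u. q (br X ?a) (basis_at i) = q ?a' (basis_at i) \<and> q (br X ?b) (basis_at i) = q ?b' (basis_at i))"
    by (auto simp: complex_eq_iff Ad_apply q_lin q_of_coords)
  also have "\<dots> \<longleftrightarrow> br X ?a = ?a' \<and> br X ?b = ?b'"
    using basis_at_eqI in_u by metis
  finally show ?thesis .
qed

lemma exists_adjoint_weight:
  assumes "X \<in> u" "X \<noteq> 0"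
  obtains c f where "c \<noteq> 0" "f \<in> supported {..<dim_u}" "f \<noteq> 0" "mat_apply {..<dim_u} (Ad X) f = cscale c f"
proof -
  obtain e where e: "e \<in> E" "br X e \<noteq> 0" by (rule bracket_nonzero[OF assms])
  then obtain j where j: "j < dim_u" "e = basis_at j" using basis_at by (auto simp: bij_betw_def)
  obtain i where i: "i < dim_u" "q (br X e) (basis_at i) \<noteq> 0"
    using basis_at_eqI[of "br X e" 0] e(2) br(2) subspace_0[OF U.subspace_T] by (auto simp: q_lin)
  have "mat_apply {..<dim_u} (Ad X) (unit_vec j) i = (\<Sum>k<dim_u. if k = j then Ad X i j else 0)"
    unfolding mat_apply_def by (intro sum.cong) (auto simp: unit_vec_def)
  then have "mat_apply {..<dim_u} (Ad X) (unit_vec j) i \<noteq> 0"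
    using i j by (simp add: Ad_def)
  then have nz: "mat_apply {..<dim_u} (Ad X) (unit_vec j) \<noteq> 0" by (metis zero_fun_apply)
  have "unit_vec j \<in> supported {..<dim_u}" using j by (auto simp: supported_def unit_vec_def)
  then show ?thesis
    using exists_nonzero_eigenvalue[of "{..<dim_u}" "mat_apply {..<dim_u} (Ad X)" "unit_vec j"]
      mat_apply_linear matrix_rep_supported[OF matrix_rep_Ad] matrix_rep_skew[OF matrix_rep_Ad] nz that
    by blast
qed

definition ideal :: "'a set \<Rightarrow> bool"
  where "ideal I \<longleftrightarrow> subspace I \<and> I \<subseteq> u \<and> (\<forall>X\<in>u. \<forall>Y\<in>I. br X Y \<in> I)"

definition minimal_ideal :: "'a set \<Rightarrow> bool"
  where "minimal_ideal I \<longleftrightarrow> ideal I \<and> I \<noteq> {0} \<and> (\<forall>J. ideal J \<and> J \<subseteq> I \<and> J \<noteq> {0} \<longrightarrow> J = I)"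

lemma exists_minimal_ideal:
  assumes "ideal K" "K \<noteq> {0}"
  obtains I where "minimal_ideal I" "I \<subseteq> K"
proof (rule exists_minimal_subspace[of "\<lambda>J. ideal J \<and> J \<noteq> {0}" K E])
  show "K \<subseteq> span E" using assms by (simp add: ideal_def U.span_frame)
  show "subspace J" if "ideal J \<and> J \<noteq> {0}" for J using that by (simp add: ideal_def)
  fix I assume I: "ideal I \<and> I \<noteq> {0}" "I \<subseteq> K" "\<And>J. ideal J \<and> J \<noteq> {0} \<Longrightarrow> J \<subseteq> I \<Longrightarrow> J = I"
  show thesis
    by (rule that[OF _ I(2)]) (use I in \<open>auto simp: minimal_ideal_def\<close>)
qed (use assms U.finite_frame in auto)

lemma minimal_ideals_disjoint:
  assumes "minimal_ideal I" "minimal_ideal J" "I \<noteq> J"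
  shows "I \<inter> J = {0}"
proof -
  have "ideal (I \<inter> J)"
    using assms by (auto simp: minimal_ideal_def ideal_def subspace_inter)
  then have "I \<inter> J = {0} \<or> I \<inter> J = I \<and> I \<inter> J = J"
    using assms unfolding minimal_ideal_def by blast
  then show ?thesis using \<open>I \<noteq> J\<close> by auto
qed

lemma minimal_ideals_commute:
  assumes I: "minimal_ideal I" and J: "minimal_ideal J" and "I \<noteq> J" "X \<in> I" "Y \<in> J"
  shows "br X Y = 0"
proof -
  have "X \<in> u" "Y \<in> u" using assms by (auto simp: minimal_ideal_def ideal_def)
  then have "br X Y \<in> J" "br Y X \<in> I"
    using assms by (auto simp: minimal_ideal_def ideal_def)
  moreover have "subspace I" using I by (simp add: minimal_ideal_def ideal_def)
  ultimately have "br X Y \<in> I \<inter> J" using br_skew[of X Y] by (simp add: subspace_neg)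
  then show ?thesis using minimal_ideals_disjoint[OF I J \<open>I \<noteq> J\<close>] by simp
qed

text \<open>
  For \<open>X\<close> and \<open>Y\<close> in different minimal ideals, \<open>ad X \<circ> ad Y\<close> vanishes, hence so does its trace.
\<close>
lemma minimal_ideals_orthogonal:
  assumes I: "minimal_ideal I" and J: "minimal_ideal J" and "I \<noteq> J" "X \<in> I" "Y \<in> J"
  shows "q X Y = 0"
proof -
  have u: "X \<in> u" "Y \<in> u" using assms by (auto simp: minimal_ideal_def ideal_def)
  have "q (br e X) (br e Y) = 0" if "e \<in> E" for e
  proof -
    have "br e Y \<in> J" using J \<open>Y \<in> J\<close> U.frame_subset[OF that] by (auto simp: minimal_ideal_def ideal_def)
    then have "br X (br e Y) = 0" by (rule minimal_ideals_commute[OF I J \<open>I \<noteq> J\<close> \<open>X \<in> I\<close>])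
    then show ?thesis
      using invariant[of X e "br e Y"] br_skew[of e X] by (simp add: q_lin)
  qed
  then show ?thesis using killing[OF u] by simp
qed

text \<open>
  One nonzero element chosen from each minimal ideal.  The chosen elements commute, and every nonzero
  ideal contains one of them; they play the role of a maximal torus in detecting kernels.
\<close>
definition ideal_gen :: "'a set \<Rightarrow> 'a" where "ideal_gen I = (SOME X. X \<in> I \<and> X \<noteq> 0)"

definition ideal_gens :: "'a set" where "ideal_gens = ideal_gen ` {I. minimal_ideal I}"

lemma ideal_gen:
  assumes "minimal_ideal I"
  shows "ideal_gen I \<in> I" "ideal_gen I \<noteq> 0" "ideal_gen I \<in> u"
proof -
  have "\<exists>X. X \<in> I \<and> X \<noteq> 0"
    using assms subspace_0[of I] by (auto simp: minimal_ideal_def ideal_def)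
  then have "ideal_gen I \<in> I \<and> ideal_gen I \<noteq> 0" unfolding ideal_gen_def by (rule someI_ex)
  then show "ideal_gen I \<in> I" "ideal_gen I \<noteq> 0" "ideal_gen I \<in> u"
    using assms by (auto simp: minimal_ideal_def ideal_def)
qed

lemma finite_ideal_gens: "finite ideal_gens"
proof -
  have orth: "q X Y = 0" if "X \<in> ideal_gens" "Y \<in> ideal_gens" "X \<noteq> Y" for X Y
    using that ideal_gen minimal_ideals_orthogonal unfolding ideal_gens_def by blast
  have "independent ideal_gens"
    unfolding dependent_explicit
  proof safe
    fix t c X assume t: "finite t" "t \<subseteq> ideal_gens" "(\<Sum>Y\<in>t. c Y *\<^sub>R Y) = 0" "X \<in> t" "c X \<noteq> 0"
    have "0 = q (\<Sum>Y\<in>t. c Y *\<^sub>R Y) X" using t(3) by (simp add: q_lin)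
    also have "\<dots> = (\<Sum>Y\<in>t. if Y = X then c X * q X X else 0)"
      unfolding bilinear_sum_left[OF U.bil]
      using t orth by (intro sum.cong) (auto simp: q_lin)
    also have "\<dots> = c X * q X X" using t by simp
    finally have "q X X = 0" using t by simp
    moreover have "X \<in> u" "X \<noteq> 0" using t(2,4) ideal_gen by (auto simp: ideal_gens_def)
    ultimately show False using U.eq_0_iff by blast
  qed
  moreover have "ideal_gens \<subseteq> span E" using ideal_gen by (auto simp: ideal_gens_def U.span_frame)
  ultimately show ?thesis using independent_span_bound[OF U.finite_frame] by blast
qed

text \<open>
  An eigenvector of \<open>ad Y\<close> with nonzero eigenvalue lies in the range of \<open>ad Y\<close>, hence in the
  complexification of the minimal ideal \<open>J\<close> of \<open>Y\<close>.  The other chosen elements commute with \<open>J\<close>.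
\<close>
lemma exists_ideal_gen_weight:
  assumes "Y \<in> ideal_gens"
  obtains c where "c \<noteq> 0" "weight {..<dim_u} Ad ideal_gens (\<lambda>X. if X = Y then c else 0)"
proof -
  obtain J where J: "minimal_ideal J" "Y = ideal_gen J" using assms by (auto simp: ideal_gens_def)
  have Y: "Y \<in> J" "Y \<noteq> 0" "Y \<in> u" using ideal_gen[OF J(1)] J(2) by auto
  obtain c f where f: "c \<noteq> 0" "f \<in> supported {..<dim_u}" "f \<noteq> 0" "mat_apply {..<dim_u} (Ad Y) f = cscale c f"
    by (rule exists_adjoint_weight[OF Y(3,2)])
  let ?a = "of_coords (\<lambda>i. Re (f i))" and ?b = "of_coords (\<lambda>i. Im (f i))"
  have eq: "br Y ?a = Re c *\<^sub>R ?a - Im c *\<^sub>R ?b" "br Y ?b = Re c *\<^sub>R ?b + Im c *\<^sub>R ?a"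
    using f(4) Ad_eigenvector_iff[OF f(2)] by auto
  have sub: "subspace J" using J by (simp add: minimal_ideal_def ideal_def)
  have brJ: "br Y Z \<in> J" if "Z \<in> u" for Z
    using J Y(1) that br_skew[of Y Z] subspace_neg[OF sub, of "br Z Y"]
    by (auto simp: minimal_ideal_def ideal_def)
  (* Solving the two relations for the real and imaginary parts means dividing by |c|^2. *)
  let ?n = "(Re c)\<^sup>2 + (Im c)\<^sup>2"
  have n: "?n \<noteq> 0" using f(1) by (simp add: complex_eq_iff sum_power2_eq_zero_iff)
  have "?n *\<^sub>R ?a = Re c *\<^sub>R br Y ?a + Im c *\<^sub>R br Y ?b"
    "?n *\<^sub>R ?b = Re c *\<^sub>R br Y ?b - Im c *\<^sub>R br Y ?a"
    unfolding eq by (simp_all add: algebra_simps power2_eq_square)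
  then have "?n *\<^sub>R ?a \<in> J" "?n *\<^sub>R ?b \<in> J"
    using brJ of_coords_in by (auto intro!: subspace_add[OF sub] subspace_diff[OF sub] subspace_scale[OF sub])
  then have ab: "?a \<in> J" "?b \<in> J"
    using subspace_scale[OF sub, of _ "inverse ?n"] n by force+
  have "mat_apply {..<dim_u} (Ad X) f = cscale (if X = Y then c else 0) f" if X: "X \<in> ideal_gens" for X
  proof (cases "X = Y")
    case False
    obtain I where I: "minimal_ideal I" "X = ideal_gen I" using X unfolding ideal_gens_def by blast
    then have "I \<noteq> J" using False J by auto
    then have "br X ?a = 0" "br X ?b = 0"
      using minimal_ideals_commute[OF I(1) J(1)] ideal_gen[OF I(1)] I(2) ab by auto
    then show ?thesis
      using False Ad_eigenvector_iff[OF f(2), of X 0] by simp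
  qed (use f in simp)
  then show ?thesis using that[of c] f unfolding weight_def by blast
qed

text \<open>
  The tensor product of adjoint representations over the list \<open>L\<close>, each factor contributing the
  eigenvector that belongs to its list entry.
\<close>
lemma exists_count_weight:
  assumes c: "\<And>Y. Y \<in> ideal_gens \<Longrightarrow> weight {..<dim_u} Ad ideal_gens (\<lambda>X. if X = Y then c Y else 0)"
    and L: "set L \<subseteq> ideal_gens"
  shows "\<exists>N M. matrix_rep N M \<and> weight N M ideal_gens (\<lambda>X. of_nat (count_list L X) * c X)"
  using L
proof (induction L)
  case Nil
  then show ?case using matrix_rep_trivial weight_trivial by auto
next
  case (Cons Y L)
  then obtain N M where NM: "matrix_rep N M" "weight N M ideal_gens (\<lambda>X. of_nat (count_list L X) * c X)" by auto
  have "weight {..<dim_u} Ad ideal_gens (\<lambda>X. if X = Y then c Y else 0)" using c Cons.prems by simp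
  then have "weight (product_index {..<dim_u} N) (\<lambda>X. tensor_mat {..<dim_u} (Ad X) N (M X)) ideal_gens
      (\<lambda>X. (if X = Y then c Y else 0) + of_nat (count_list L X) * c X)"
    by (rule weight_tensor[OF matrix_rep_Ad NM(1) _ NM(2)])
  moreover have "(\<lambda>X. (if X = Y then c Y else 0) + of_nat (count_list L X) * c X)
      = (\<lambda>X. of_nat (count_list (Y # L) X) * c X)"
    by (auto simp: fun_eq_iff algebra_simps)
  ultimately show ?case
    using matrix_rep_tensor[OF matrix_rep_Ad NM(1)] by metis
qed

end

section \<open>The Killing form as an inner product\<close>

text \<open>
  Both the bracket and the Killing form are composed with a linear projection \<open>P\<close> onto \<open>u\<close>.  Symmetry and
  invariance of the Killing form come from cyclicity of the trace \<open>\<tau>\<close>; definiteness is the hypothesis.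
\<close>
lemma compact_lie_exists:
  fixes u :: "'a::real_vector set"
  assumes lie: "real_lie_algebra u br" and css: "real_lie_algebra.compact_semisimple u br"
  obtains q E br' where "compact_lie q E u br'" "\<And>X Y. X \<in> u \<Longrightarrow> Y \<in> u \<Longrightarrow> br' X Y = br X Y"
proof -
  interpret L: real_lie_algebra u br by (rule lie)
  obtain B0 where B0: "finite B0" "span B0 = u" using L.finite_dimensional by blast
  have sub: "subspace u" using B0 by (metis subspace_span)
  obtain P where P: "linear P" "\<And>x. P x \<in> u" "\<And>x. x \<in> u \<Longrightarrow> P x = x"
    by (rule exists_linear_projection[OF sub]) (rule that)
  obtain B where B: "B \<subseteq> u" "independent B" "u \<subseteq> span B" by (rule maximal_independent_subset)
  have finB: "finite B" using independent_span_bound[OF B0(1) B(2)] B(1) B0(2) by auto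
  have spanB: "span B = u" using B sub by (simp add: span_minimal subset_antisym)
  define \<phi> where "\<phi> b x = representation B (P x) b" for b x
  have \<phi>_lin: "linear (\<phi> b)" for b
    using B(2) P(2) spanB unfolding \<phi>_def
    by (intro linearI)
      (simp_all add: linear_add[OF P(1)] linear_scale[OF P(1)] representation_add representation_scale)
  have exp: "(\<Sum>b\<in>B. \<phi> b x *\<^sub>R b) = x" if "x \<in> u" for x
    using sum_representation_eq[OF B(2) _ finB, of x] that spanB by (simp add: \<phi>_def P(3))
  have tr: "trace_on u f = (\<Sum>b\<in>B. \<phi> b (f b))" if "real_linear_on u u f" for f
    by (rule trace_on_dual_frame[OF finB spanB _ exp that]) (auto intro!: real_linear_on_linear \<phi>_lin)

  define br' where "br' X Y = br (P X) (P Y)" for X Y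
  have br_add: "br (x + y) z = br x z + br y z" "br z (x + y) = br z x + br z y"
    if "x \<in> u" "y \<in> u" "z \<in> u" for x y z
    using L.bilinear that unfolding real_bilinear_on_def linear_on_def by (auto simp: Pi_iff)
  have br_scale: "br (c *\<^sub>R x) z = c *\<^sub>R br x z" "br z (c *\<^sub>R x) = c *\<^sub>R br z x" "br x z \<in> u"
    if "x \<in> u" "z \<in> u" for x z c
    using L.bilinear that unfolding real_bilinear_on_def linear_on_def by (auto simp: Pi_iff)
  note br_lin = br_add br_scale
  have br': "bilinear br'"
    unfolding br'_def using P(2)
    by (intro bilinearI) (simp_all add: linear_add[OF P(1)] linear_scale[OF P(1)] br_lin)
  note br'_lin = bilinear_simps[OF br']
  have br'_in: "br' X Y \<in> u" for X Y unfolding br'_def by (rule br_lin(5)[OF P(2) P(2)])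
  have br'_alt: "br' X X = 0" for X unfolding br'_def by (rule L.alternating[OF P(2)])
  have br'_jac: "br' X (br' Y Z) + br' Y (br' Z X) + br' Z (br' X Y) = 0" for X Y Z
    using L.jacobi[OF P(2) P(2) P(2)] br'_in P(3) unfolding br'_def by (metis (no_types))
  have br'_skew: "br' X Y = - br' Y X" for X Y
    using br'_alt[of "X + Y"] br'_alt[of X] br'_alt[of Y] by (simp add: br'_lin eq_neg_iff_add_eq_0 add.commute)
  have br'_br: "br' (br' X Y) Z = br' X (br' Y Z) - br' Y (br' X Z)" for X Y Z
    using br'_jac[of X Y Z] br'_skew[of Z "br' X Y"] br'_skew[of Z X] by (simp add: br'_lin algebra_simps)
  have agree: "br' X Y = br X Y" if "X \<in> u" "Y \<in> u" for X Y
    using that by (simp add: br'_def P(3))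

  define \<tau> where "\<tau> f = (\<Sum>b\<in>B. \<phi> b (f b))" for f
  have cyclic: "\<tau> (\<lambda>Z. f (g Z)) = \<tau> (\<lambda>Z. g (f Z))"
    if "linear f" "linear g" "\<And>x. f x \<in> u" "\<And>x. g x \<in> u" for f g
  proof -
    have *: "\<tau> (\<lambda>Z. f (g Z)) = (\<Sum>b\<in>B. \<Sum>c\<in>B. \<phi> c (g b) * \<phi> b (f c))"
      if "linear f" "\<And>x. g x \<in> u" for f g
      unfolding \<tau>_def
    proof (rule sum.cong[OF refl])
      fix b
      have "\<phi> b (f (g b)) = \<phi> b (f (\<Sum>c\<in>B. \<phi> c (g b) *\<^sub>R c))" using exp[OF that(2)] by simp
      also have "\<dots> = (\<Sum>c\<in>B. \<phi> c (g b) * \<phi> b (f c))"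
        by (simp add: linear_sum[OF that(1)] linear_scale[OF that(1)] linear_sum[OF \<phi>_lin] linear_scale[OF \<phi>_lin])
      finally show "\<phi> b (f (g b)) = (\<Sum>c\<in>B. \<phi> c (g b) * \<phi> b (f c))" .
    qed
    show ?thesis
      unfolding *[OF that(1,4)] *[OF that(2,3)] by (subst sum.swap) (simp add: mult.commute)
  qed
  have lin1: "linear (br' X)" for X using br' by (simp add: bilinear_def)
  have lin2: "linear (\<lambda>Z. br' X (br' Y Z))" for X Y by (rule linearI) (simp_all add: br'_lin)

  define q where "q X Y = - \<tau> (\<lambda>Z. br' X (br' Y Z))" for X Y
  have q_bil: "bilinear q"
    by (rule bilinearI)
      (simp_all add: q_def \<tau>_def br'_lin linear_add[OF \<phi>_lin] linear_scale[OF \<phi>_lin] sum.distrib sum_distrib_left)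
  have q_sym: "q X Y = q Y X" for X Y
    unfolding q_def by (simp add: cyclic[OF lin1 lin1 br'_in br'_in])
  have q_inv: "q (br' X Y) Z = - q Y (br' X Z)" for X Y Z
  proof -
    have "\<tau> (\<lambda>W. br' (br' X Y) (br' Z W)) = \<tau> (\<lambda>W. br' X (br' Y (br' Z W))) - \<tau> (\<lambda>W. br' Y (br' X (br' Z W)))"
      by (simp add: \<tau>_def br'_br linear_diff[OF \<phi>_lin] sum_subtractf)
    moreover have "\<tau> (\<lambda>W. br' Y (br' (br' X Z) W)) = \<tau> (\<lambda>W. br' Y (br' X (br' Z W))) - \<tau> (\<lambda>W. br' Y (br' Z (br' X W)))"
      by (simp add: \<tau>_def br'_br br'_lin linear_diff[OF \<phi>_lin] sum_subtractf)
    moreover have "\<tau> (\<lambda>W. br' X (br' Y (br' Z W))) = \<tau> (\<lambda>W. br' Y (br' Z (br' X W)))"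
      by (rule cyclic[OF lin1 lin2 br'_in br'_in])
    ultimately show ?thesis by (simp add: q_def)
  qed
  have trace_q: "q X Y = - trace_on u (\<lambda>Z. br' X (br' Y Z))" for X Y
    unfolding q_def \<tau>_def by (subst tr) (auto intro!: real_linear_on_linear lin2 br'_in)
  have "q X X > 0" if "X \<in> u" "X \<noteq> 0" for X
  proof -
    have "L.killing_form X X < 0" using css that unfolding L.compact_semisimple_def by blast
    moreover have "L.killing_form X X = trace_on u (\<lambda>Z. br' X (br' X Z))"
    proof -
      have f: "real_linear_on u u (\<lambda>Z. br X (br X Z))"
        using that br_lin unfolding linear_on_def by auto
      have "\<phi> b (br X (br X b)) = \<phi> b (br' X (br' X b))" if b: "b \<in> B" for b
        using b B(1) \<open>X \<in> u\<close> by (metis agree br'_in subsetD)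
      then show ?thesis
        unfolding L.killing_form_def tr[OF f]
        by (subst tr) (auto intro!: real_linear_on_linear lin2 br'_in)
    qed
    ultimately show ?thesis using trace_q by simp
  qed
  then obtain E where "orthonormal_frame q E (span B)"
    using gram_schmidt[of q B] q_bil q_sym finB spanB by metis
  then interpret Q: orthonormal_frame q E u by (simp add: spanB)
  have "compact_lie q E u br'"
  proof (unfold_locales, goal_cases)
    case (6 X Y)
    have "q X Y = - (\<Sum>e\<in>E. q (br' X (br' Y e)) e)"
      unfolding trace_q[of X Y] by (subst Q.trace) (auto intro!: real_linear_on_linear lin2 br'_in)
    also have "\<dots> = (\<Sum>e\<in>E. q (br' e X) (br' e Y))"
      unfolding sum_negf[symmetric]
    proof (rule sum.cong[OF refl])
      fix e
      show "- q (br' X (br' Y e)) e = q (br' e X) (br' e Y)"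
        using q_inv[of X "br' Y e" e] br'_skew[of Y e] br'_skew[of X e] q_sym[of "br' e X" "br' e Y"]
        by (simp add: bilinear_simps[OF q_bil] br'_lin)
    qed
    finally show ?case by simp
  qed (rule br' br'_in br'_alt br'_jac q_inv)+
  then show ?thesis using that agree by blast
qed

section \<open>Irreducible and faithful subrepresentations\<close>

context compact_lie
begin

definition invariant_subspace :: "nat set \<Rightarrow> ('a \<Rightarrow> nat \<Rightarrow> nat \<Rightarrow> complex) \<Rightarrow> cvec set \<Rightarrow> bool"
  where "invariant_subspace N M V \<longleftrightarrow> cvec.subspace V \<and> V \<subseteq> supported N \<and>
    (\<forall>X\<in>u. \<forall>v\<in>V. mat_apply N (M X) v \<in> V)"

text \<open>
  Let \<open>d\<close> be the defect of the eigenvector equation for the projection \<open>w\<close>.  It lies in \<open>W\<close>, while the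
  defect for \<open>v - w\<close> is \<open>- d\<close> and is orthogonal to \<open>W\<close>, since \<open>W\<close> is invariant under skew operators.
  So \<open>d\<close> is orthogonal to itself.
\<close>
lemma weight_vector_projection:
  assumes M: "matrix_rep N M" and W: "invariant_subspace N M W" and H: "H \<subseteq> u"
    and v: "\<forall>X\<in>H. mat_apply N (M X) v = cscale (c X) v"
    and w: "w \<in> W" "\<And>x. x \<in> W \<Longrightarrow> hermitian_re N (v - w) x = 0"
  shows "\<forall>X\<in>H. mat_apply N (M X) w = cscale (c X) w"
proof
  fix X assume X: "X \<in> H"
  interpret T: Vector_Spaces.linear cscale cscale "mat_apply N (M X)" by (rule mat_apply_linear)
  note h_lin = bilinear_simps[OF bilinear_hermitian_re]
  have Wsub: "cvec.subspace W" "W \<subseteq> supported N" using W by (auto simp: invariant_subspace_def)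
  have inv: "mat_apply N (M X) x \<in> W" if "x \<in> W" for x
    using W X H that by (auto simp: invariant_subspace_def)
  define d where "d = mat_apply N (M X) w - cscale (c X) w"
  have dW: "d \<in> W" unfolding d_def
    by (intro cvec.subspace_diff[OF Wsub(1)] cvec.subspace_scale[OF Wsub(1)] inv w(1))
  have "mat_apply N (M X) (v - w) - cscale (c X) (v - w) = - d"
    using v X by (simp add: T.diff cvec.scale_right_diff_distrib d_def)
  then have "- hermitian_re N d d = hermitian_re N (mat_apply N (M X) (v - w) - cscale (c X) (v - w)) d"
    by (simp add: h_lin)
  also have "\<dots> = - hermitian_re N (v - w) (mat_apply N (M X) d) - hermitian_re N (v - w) (cscale (cnj (c X)) d)"
    by (simp only: h_lin matrix_rep_skew[OF M] hermitian_re_cscale)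
  also have "\<dots> = 0"
    using w(2)[OF inv[OF dW]] w(2)[OF cvec.subspace_scale[OF Wsub(1) dW]] by simp
  finally have "hermitian_re N d d = 0" by simp
  then have "d = 0"
    using hermitian_re_pos[OF matrix_repD(1)[OF M], of d] dW Wsub(2) by fastforce
  then show "mat_apply N (M X) w = cscale (c X) w" by (simp add: d_def)
qed

text \<open>
  A minimal invariant subspace \<open>V\<close> among those containing a common eigenvector is irreducible: given an invariant
  subspace \<open>W\<close> of \<open>V\<close>, either the projection of the eigenvector to \<open>W\<close> is nonzero and \<open>W\<close>
  competes with \<open>V\<close>, or the eigenvector lies in the orthogonal complement of \<open>W\<close>, which then competes with \<open>V\<close>.
\<close>
lemma exists_irreducible_weight_subspace:
  assumes M: "matrix_rep N M" and H: "H \<subseteq> u" and c: "weight N M H c"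
  obtains V v where "invariant_subspace N M V" "v \<in> V" "v \<noteq> 0"
    "\<And>X. X \<in> H \<Longrightarrow> mat_apply N (M X) v = cscale (c X) v"
    "\<And>W. invariant_subspace N M W \<Longrightarrow> W \<subseteq> V \<Longrightarrow> W = {0} \<or> W = V"
proof -
  have N: "finite N" by (rule matrix_repD[OF M])
  let ?P = "\<lambda>V. invariant_subspace N M V \<and> (\<exists>v\<in>V. v \<noteq> 0 \<and> (\<forall>X\<in>H. mat_apply N (M X) v = cscale (c X) v))"
  have P0: "?P (supported N)"
    using c matrix_rep_supported[OF M] subspace_supported
    by (auto simp: invariant_subspace_def weight_def)
  have sub: "subspace V" if "?P V" for V
    using that complex_subspace_real by (auto simp: invariant_subspace_def)
  show ?thesis
  proof (rule exists_minimal_subspace[of ?P "supported N", OF P0 real_span_supported[OF N] _ sub])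
    fix V assume V: "?P V" "\<And>W. ?P W \<Longrightarrow> W \<subseteq> V \<Longrightarrow> W = V"
    then obtain v where v: "v \<in> V" "v \<noteq> 0" "\<forall>X\<in>H. mat_apply N (M X) v = cscale (c X) v" by blast
    have inV: "invariant_subspace N M V" using V by blast
    show thesis
    proof (rule that[OF inV v(1,2)])
      show "mat_apply N (M X) v = cscale (c X) v" if "X \<in> H" for X using v that by blast
      fix W assume W: "invariant_subspace N M W" "W \<subseteq> V"
      have Wsub: "cvec.subspace W" "W \<subseteq> supported N" using W by (auto simp: invariant_subspace_def)
      obtain B where "orthonormal_frame (hermitian_re N) B W"
        by (rule exists_real_frame[OF N complex_subspace_real[OF Wsub(1)] Wsub(2)])
      then interpret B: orthonormal_frame "hermitian_re N" B W .
      obtain w where w: "w \<in> W" "\<And>x. x \<in> W \<Longrightarrow> hermitian_re N (v - w) x = 0"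
        using B.orthogonal_projection by blast
      show "W = {0} \<or> W = V"
      proof (cases "w = 0")
        case False
        then have "?P W" using weight_vector_projection[OF M W(1) H v(3) w] w W by blast
        then show ?thesis using V(2) W by blast
      next
        case True
        (* The eigenvector v lies in the orthogonal complement of W, which must then be all of V. *)
        let ?C = "{x \<in> V. \<forall>y\<in>W. hermitian_re N x y = 0}"
        note h_lin = bilinear_simps[OF bilinear_hermitian_re]
        have Vsub: "cvec.subspace V" "V \<subseteq> supported N" using inV by (auto simp: invariant_subspace_def)
        have "cvec.subspace ?C"
          using Vsub(1) Wsub(1)
          by (auto simp: cvec.subspace_def h_lin hermitian_re_cscale)
        moreover have "mat_apply N (M X) x \<in> ?C" if "X \<in> u" "x \<in> ?C" for X x
          using that inV W(1) by (auto simp: invariant_subspace_def matrix_rep_skew[OF M])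
        ultimately have "invariant_subspace N M ?C"
          using Vsub by (auto simp: invariant_subspace_def)
        moreover have "v \<in> ?C" using v(1) w(2) True by simp
        ultimately have "?C = V" using V(2)[of ?C] v by blast
        then have "hermitian_re N x x = 0" if "x \<in> W" for x using that W(2) by blast
        then have "W \<subseteq> {0}" using hermitian_re_pos[OF N] Wsub(2) by fastforce
        then show ?thesis using cvec.subspace_0[OF Wsub(1)] by blast
      qed
    qed
  qed (use N in simp)
qed

text \<open>
  The kernel is an ideal.  A nonzero ideal contains a minimal one and hence some chosen element, which however
  acts on \<open>v\<close> by a nonzero scalar.
\<close>
lemma faithful_of_nonzero_weight:
  assumes M: "matrix_rep N M" and V: "invariant_subspace N M V" and v: "v \<in> V" "v \<noteq> 0"
    and w: "\<And>X. X \<in> ideal_gens \<Longrightarrow> mat_apply N (M X) v = cscale (c X) v" "\<And>X. X \<in> ideal_gens \<Longrightarrow> c X \<noteq> 0"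
    and X: "X \<in> u" "\<forall>v\<in>V. mat_apply N (M X) v = 0"
  shows "X = 0"
proof (rule ccontr)
  assume "X \<noteq> 0"
  define K where "K = {X \<in> u. \<forall>v\<in>V. mat_apply N (M X) v = 0}"
  note act = bilinear_simps[OF matrix_rep_bilinear[OF M]]
  have "subspace K"
    unfolding K_def subspace_def using U.subspace_T
    by (auto simp: act subspace_0 subspace_add subspace_scale)
  moreover have "br Y Z \<in> K" if "Y \<in> u" "Z \<in> K" for Y Z
    using that V br(2) bilinear_rzero[OF matrix_rep_bilinear[OF M]]
    by (auto simp: K_def matrix_rep_bracket[OF M] invariant_subspace_def)
  ultimately have "ideal K" by (auto simp: ideal_def K_def)
  moreover have "X \<in> K" using X by (simp add: K_def)
  ultimately obtain I where I: "minimal_ideal I" "I \<subseteq> K"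
    using exists_minimal_ideal \<open>X \<noteq> 0\<close> by (metis singletonD)
  then have "ideal_gen I \<in> K" "ideal_gen I \<in> ideal_gens" using ideal_gen by (auto simp: ideal_gens_def)
  then have "cscale (c (ideal_gen I)) v = 0" using w(1) v by (auto simp: K_def)
  then show False using w(2) \<open>ideal_gen I \<in> ideal_gens\<close> v by (simp add: cvec.scale_eq_0_iff)
qed

text \<open>
  The complex-linear extension of the action, with \<open>(X, Y)\<close> standing for \<open>X + \<i> Y\<close>.
\<close>
definition complexified :: "nat set \<Rightarrow> ('a \<Rightarrow> nat \<Rightarrow> nat \<Rightarrow> complex) \<Rightarrow> 'a \<times> 'a \<Rightarrow> cvec \<Rightarrow> cvec"
  where "complexified N M = (\<lambda>(X, Y) v. mat_apply N (M X) v + cscale \<i> (mat_apply N (M Y) v))"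


lemma complexified_real: "matrix_rep N M \<Longrightarrow> complexified N M (X, 0) v = mat_apply N (M X) v"
  using bilinear_lzero[OF matrix_rep_bilinear, of N M v] by (simp add: complexified_def)

lemma cspan_invariant_subspace:
  assumes M: "matrix_rep N M" and V: "invariant_subspace N M V"
  shows "\<exists>B. finite B \<and> cvec.span B = V"
proof -
  have N: "finite N" by (rule matrix_repD[OF M])
  have sub: "cvec.subspace V" "V \<subseteq> supported N" using V by (auto simp: invariant_subspace_def)
  obtain B where B: "B \<subseteq> V" "cvec.independent B" "V \<subseteq> cvec.span B"
    by (rule cvec.maximal_independent_subset)
  have "B \<subseteq> cvec.span (unit_vec ` N)" using B(1) sub(2) supported_subset_span[OF N] by blast
  then have "finite B"
    using cvec.independent_span_bound[of "unit_vec ` N" B] B(2) N by blast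
  moreover have "cvec.span B = V" using B sub by (simp add: cvec.span_minimal subset_antisym)
  ultimately show ?thesis by blast
qed

lemma is_representation_complexified:
  assumes M: "matrix_rep N M" and V: "invariant_subspace N M V"
    and agree: "\<And>X Y. X \<in> u \<Longrightarrow> Y \<in> u \<Longrightarrow> br X Y = br0 X Y"
  shows "is_representation u br0 (V, complexified N M)"
  unfolding is_representation_def prod.case
proof (intro conjI ballI cspan_invariant_subspace[OF M V])
  note act = bilinear_simps[OF matrix_rep_bilinear[OF M]]
  have lin: "mat_apply N (M X) (v + w) = mat_apply N (M X) v + mat_apply N (M X) w"
    "mat_apply N (M X) (v - w) = mat_apply N (M X) v - mat_apply N (M X) w"
    "mat_apply N (M X) (cscale c v) = cscale c (mat_apply N (M X) v)" for X v w c
  proof -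
    interpret T: Vector_Spaces.linear cscale cscale "mat_apply N (M X)" by (rule mat_apply_linear)
    show "mat_apply N (M X) (v + w) = mat_apply N (M X) v + mat_apply N (M X) w"
      "mat_apply N (M X) (v - w) = mat_apply N (M X) v - mat_apply N (M X) w"
      "mat_apply N (M X) (cscale c v) = cscale c (mat_apply N (M X) v)"
      by (rule T.add T.diff T.scale)+
  qed
  have sub: "cvec.subspace V" using V by (simp add: invariant_subspace_def)
  have in_V: "complexified N M A v \<in> V" if "A \<in> cplx_carrier u" "v \<in> V" for A v
    using that V unfolding complexified_def cplx_carrier_def
    by (auto simp: invariant_subspace_def intro!: cvec.subspace_add[OF sub] cvec.subspace_scale[OF sub])
  show "linear_on cscale cscale V V (complexified N M A)" if "A \<in> cplx_carrier u" for A
    using in_V[OF that] unfolding linear_on_def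
    by (cases A) (auto simp: complexified_def lin cvec.scale_right_distrib mult.commute)
  show "linear_on cplx_scale cscale (cplx_carrier u) V (\<lambda>A. complexified N M A v)" if "v \<in> V" for v
    using in_V[OF _ that] unfolding linear_on_def
    by (auto simp: complexified_def act cvec.scale_right_distrib cplx_scale_def fun_eq_iff cscale_def
        scaleR_fun_def complex_eq_iff algebra_simps)
  fix A B v assume AB: "A \<in> cplx_carrier u" "B \<in> cplx_carrier u"
  obtain X Y X' Y' where A: "A = (X, Y)" "B = (X', Y')" by (cases A; cases B)
  then have u: "X \<in> u" "Y \<in> u" "X' \<in> u" "Y' \<in> u" using AB by (auto simp: cplx_carrier_def)
  have "cplx_bracket br0 A B = (br X X' - br Y Y', br X Y' + br Y X')"
    using u by (simp add: cplx_bracket_def A agree)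
  then show "complexified N M (cplx_bracket br0 A B) v =
      complexified N M A (complexified N M B v) - complexified N M B (complexified N M A v)"
    unfolding A complexified_def
    by (simp add: act matrix_rep_bracket[OF M] lin cvec.scale_right_distrib cvec.scale_right_diff_distrib)
qed

lemma irreducible_complexified:
  assumes M: "matrix_rep N M" and V: "invariant_subspace N M V" and v: "v \<in> V" "v \<noteq> 0"
    and irr: "\<And>W. invariant_subspace N M W \<Longrightarrow> W \<subseteq> V \<Longrightarrow> W = {0} \<or> W = V"
    and agree: "\<And>X Y. X \<in> u \<Longrightarrow> Y \<in> u \<Longrightarrow> br X Y = br0 X Y"
  shows "irreducible_rep u br0 (V, complexified N M)"
  unfolding irreducible_rep_def prod.case
proof (intro conjI allI impI)
  show "is_representation u br0 (V, complexified N M)"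
    by (rule is_representation_complexified[OF M V agree])
  show "V \<noteq> {0}" using v by auto
  fix W assume W: "cvec.subspace W \<and> W \<subseteq> V \<and> (\<forall>A\<in>cplx_carrier u. complexified N M A ` W \<subseteq> W)"
  have "mat_apply N (M X) w \<in> W" if "X \<in> u" "w \<in> W" for X w
  proof -
    have "(X, 0) \<in> cplx_carrier u" using that subspace_0[OF U.subspace_T] by (simp add: cplx_carrier_def)
    then have "complexified N M (X, 0) w \<in> W" using W that by blast
    then show ?thesis by (simp add: complexified_real[OF M])
  qed
  then have "invariant_subspace N M W"
    using W V by (auto simp: invariant_subspace_def)
  then show "W = {0} \<or> W = V" using irr W by blast
qed

lemma admits_negative_ricci_faithful:
  assumes M: "matrix_rep N M" and V: "invariant_subspace N M V" "V \<noteq> {0}"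
    and faithful: "\<And>X. X \<in> u \<Longrightarrow> \<forall>v\<in>V. mat_apply N (M X) v = 0 \<Longrightarrow> X = 0"
  shows "admits_negative_ricci (semidirect_carrier u V)
    (semidirect_bracket br (restrict_rep (complexified N M)))"
proof -
  have N: "finite N" by (rule matrix_repD[OF M])
  have sub: "cvec.subspace V" "V \<subseteq> supported N" using V by (auto simp: invariant_subspace_def)
  obtain B where B: "orthonormal_frame (hermitian_re N) B V"
    by (rule exists_real_frame[OF N complex_subspace_real[OF sub(1)] sub(2)])
  then interpret B: orthonormal_frame "hermitian_re N" B V .
  have eq: "restrict_rep (complexified N M) = (\<lambda>X v. mat_apply N (M X) v)"
    by (auto simp: fun_eq_iff restrict_rep_def complexified_real[OF M])
  show ?thesis
    unfolding eq
  proof (rule admits_negative_ricci_of_skew_faithful[OF B])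
    show "B \<noteq> {}" using B.span_frame V(2) by auto
    show "bilinear (\<lambda>X v. mat_apply N (M X) v)" by (rule matrix_rep_bilinear[OF M])
    show "mat_apply N (M X) v \<in> V" if "X \<in> u" "v \<in> V" for X v
      using V that by (auto simp: invariant_subspace_def)
    show "mat_apply N (M (br X Y)) v = mat_apply N (M X) (mat_apply N (M Y) v) - mat_apply N (M Y) (mat_apply N (M X) v)"
      for X Y v by (rule matrix_rep_bracket[OF M])
    show "hermitian_re N (mat_apply N (M X) v) w = - hermitian_re N v (mat_apply N (M X) w)" for X v w
      by (rule matrix_rep_skew[OF M])
  qed (rule faithful)
qed

end

section \<open>Infinitely many representations\<close>

text \<open>
  Passes from the bracket extended to the whole type back to the given one, which agrees with it on \<open>g\<close>.
\<close>
lemma admits_negative_ricci_cong: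
  assumes "admits_negative_ricci g br"
    and agree: "\<And>X Y. X \<in> g \<Longrightarrow> Y \<in> g \<Longrightarrow> br' X Y = br X Y"
  shows "admits_negative_ricci g br'"
proof -
  obtain ip where ip: "metric_lie_algebra g br ip" "metric_lie_algebra.negative_ricci g br ip"
    using assms(1) by (auto simp: admits_negative_ricci_def)
  interpret M: metric_lie_algebra g br ip by (rule ip(1))
  have sub: "subspace g" using M.finite_dimensional by (metis subspace_span)
  have br_in: "br X Y \<in> g" if "X \<in> g" "Y \<in> g" for X Y
    using M.bilinear that by (auto simp: real_bilinear_on_def linear_on_def Pi_iff)
  interpret M': metric_lie_algebra g br' ip
  proof unfold_locales
    show "real_bilinear_on g g g br'"
      using M.bilinear agree subspace_add[OF sub] subspace_scale[OF sub]
      by (simp add: real_bilinear_on_def linear_on_def Pi_iff)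
    show "br' X (br' Y Z) + br' Y (br' Z X) + br' Z (br' X Y) = 0" if "X \<in> g" "Y \<in> g" "Z \<in> g" for X Y Z
      using M.jacobi[OF that] that br_in by (simp add: agree)
  qed (use M.finite_dimensional M.alternating M.ip_bilinear M.ip_symmetric M.ip_positive agree in auto)
  have lc: "M'.levi_civita D \<longleftrightarrow> M.levi_civita D" for D
    using agree by (simp add: M.levi_civita_def M'.levi_civita_def)
  have ric: "M'.ricci D X Y = M.ricci D X Y" if "X \<in> g" for D X Y
    unfolding M.ricci_def M'.ricci_def
    by (rule trace_on_cong[OF sub]) (simp add: M.curvature_def M'.curvature_def agree that)
  have "M'.negative_ricci"
    using ip(2) unfolding M.negative_ricci_def M'.negative_ricci_def lc by (simp add: ric)
  then show ?thesis
    unfolding admits_negative_ricci_def using M'.metric_lie_algebra_axioms by blast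
qed

text \<open>
  The set of eigenvalues of a fixed element is an invariant of equivalence.  Its supremum in absolute
  value is unbounded on the representations that occur in tensor powers, so they cannot all be equivalent to
  finitely many of them.
\<close>
definition eigenvalues :: "'a \<Rightarrow> cvec set \<times> ('a \<Rightarrow> cvec \<Rightarrow> cvec) \<Rightarrow> complex set"
  where "eigenvalues A = (\<lambda>(V, \<pi>). {z. \<exists>v\<in>V. v \<noteq> 0 \<and> \<pi> A v = cscale z v})"

lemma equivalent_rep_eigenvalues:
  assumes eqv: "equivalent_rep u r r'" and rep: "is_representation u br r" and A: "A \<in> cplx_carrier u"
  shows "eigenvalues A r = eigenvalues A r'"
proof -
  obtain V \<pi> W \<rho> where r: "r = (V, \<pi>)" "r' = (W, \<rho>)" by (cases r; cases r')
  obtain T where T: "linear_on cscale cscale V W T" "bij_betw T V W"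
    "\<And>v. v \<in> V \<Longrightarrow> T (\<pi> A v) = \<rho> A (T v)"
    using eqv A unfolding r equivalent_rep_def by auto
  obtain B where "cvec.span B = V" using rep by (auto simp: r is_representation_def)
  then have sub: "cvec.subspace V" by (metis cvec.subspace_span)
  have piV: "\<pi> A v \<in> V" if "v \<in> V" for v
    using rep A that by (auto simp: r is_representation_def linear_on_def)
  have sc: "T (cscale z v) = cscale z (T v)" "cscale z v \<in> V" if "v \<in> V" for z v
    using T(1) that cvec.subspace_scale[OF sub] by (auto simp: linear_on_def)
  have inj: "T v = T w \<longleftrightarrow> v = w" if "v \<in> V" "w \<in> V" for v w
    using T(2) that by (auto simp: bij_betw_def inj_on_def)
  have T0: "T 0 = 0"
    using sc(1)[OF cvec.subspace_0[OF sub], of 0] by simp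
  have "(T v \<noteq> 0 \<and> \<rho> A (T v) = cscale z (T v)) \<longleftrightarrow> (v \<noteq> 0 \<and> \<pi> A v = cscale z v)" if v: "v \<in> V" for v z
  proof -
    have "T v = 0 \<longleftrightarrow> v = 0" using inj[OF v cvec.subspace_0[OF sub]] T0 by simp
    moreover have "\<rho> A (T v) = cscale z (T v) \<longleftrightarrow> \<pi> A v = cscale z v"
      using T(3)[OF v] sc(1)[OF v, of z] inj[OF piV[OF v] sc(2)[OF v], of z] by metis
    ultimately show ?thesis by blast
  qed
  moreover have "W = T ` V" using T(2) by (simp add: bij_betw_def)
  ultimately show ?thesis by (auto simp: eigenvalues_def r)
qed

lemma mat_apply_eigenvalue_bound:
  assumes N: "finite N" and v: "v \<in> supported N" "v \<noteq> 0" and ev: "mat_apply N M v = cscale z v"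
  shows "norm z \<le> (\<Sum>i\<in>N. \<Sum>j\<in>N. norm (M i j))"
proof -
  obtain k where "v k \<noteq> 0" using v(2) by (auto simp: fun_eq_iff)
  then have k: "k \<in> N" using v(1) by (auto simp: supported_def)
  obtain i where i: "i \<in> N" "\<And>j. j \<in> N \<Longrightarrow> norm (v j) \<le> norm (v i)"
    using Max_in[of "(\<lambda>j. norm (v j)) ` N"] Max_ge[of "(\<lambda>j. norm (v j)) ` N"] N k by fastforce
  have pos: "norm (v i) > 0" using i(2)[OF k] \<open>v k \<noteq> 0\<close> by (smt (verit) zero_less_norm_iff)
  have "norm z * norm (v i) = norm (\<Sum>j\<in>N. M i j * v j)"
    using ev by (simp add: mat_apply_def cscale_def fun_eq_iff norm_mult)
  also have "\<dots> \<le> (\<Sum>j\<in>N. norm (M i j) * norm (v j))"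
    by (rule order.trans[OF norm_sum]) (simp add: norm_mult)
  also have "\<dots> \<le> (\<Sum>j\<in>N. norm (M i j)) * norm (v i)"
    unfolding sum_distrib_right using i(2) by (intro sum_mono mult_left_mono) auto
  finally have "norm z \<le> (\<Sum>j\<in>N. norm (M i j))" using pos by simp
  also have "\<dots> \<le> (\<Sum>i\<in>N. \<Sum>j\<in>N. norm (M i j))"
    using i(1) N by (intro member_le_sum) (auto intro: sum_nonneg)
  finally show ?thesis .
qed

theorem theorem3p5:
  fixes u :: "'a::real_vector set" and br :: "'a \<Rightarrow> 'a \<Rightarrow> 'a"
  assumes "real_lie_algebra u br"
    and "real_lie_algebra.compact_semisimple u br"
    and "u \<noteq> {0}"
  shows "\<exists>R :: 'a cplx_rep set. infinite R \<and>
    pairwise (\<lambda>r r'. \<not> equivalent_rep u r r') R \<and>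
    (\<forall>(V, \<pi>)\<in>R. irreducible_rep u br (V, \<pi>) \<and>
       admits_negative_ricci (semidirect_carrier u V) (semidirect_bracket br (restrict_rep \<pi>)))"
proof -
  obtain q E br' where C: "compact_lie q E u br'"
    and agree: "\<And>X Y. X \<in> u \<Longrightarrow> Y \<in> u \<Longrightarrow> br' X Y = br X Y"
    by (rule compact_lie_exists[OF assms(1,2)]) (rule that)
  interpret compact_lie q E u br' by (rule C)
  have "ideal u" using U.subspace_T br(2) by (auto simp: ideal_def)
  then obtain I where "minimal_ideal I" using exists_minimal_ideal assms(3) by blast
  then obtain X0 where X0: "X0 \<in> ideal_gens" "X0 \<in> u" using ideal_gen by (auto simp: ideal_gens_def)
  have ideal_gens_u: "ideal_gens \<subseteq> u" using ideal_gen by (auto simp: ideal_gens_def)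
  have "\<forall>Y\<in>ideal_gens. \<exists>c. c \<noteq> 0 \<and> weight {..<dim_u} Ad ideal_gens (\<lambda>X. if X = Y then c else 0)"
    using exists_ideal_gen_weight by metis
  then obtain c where c: "\<And>Y. Y \<in> ideal_gens \<Longrightarrow> c Y \<noteq> 0"
    "\<And>Y. Y \<in> ideal_gens \<Longrightarrow> weight {..<dim_u} Ad ideal_gens (\<lambda>X. if X = Y then c Y else 0)"
    by metis
  obtain xs where xs: "set xs = ideal_gens" using finite_list[OF finite_ideal_gens] by blast
  let ?A = "(X0, 0)"
  have A: "?A \<in> cplx_carrier u"
    using X0 subspace_0[OF U.subspace_T] by (simp add: cplx_carrier_def)
  let ?good = "\<lambda>r. irreducible_rep u br r \<and>
      admits_negative_ricci (semidirect_carrier u (fst r)) (semidirect_bracket br (restrict_rep (snd r)))"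
  let ?s = "\<lambda>r. Sup (norm ` eigenvalues ?A r)"
  have "\<exists>r. ?good r \<and> real k * norm (c X0) \<le> ?s r" for k
  proof -
    (* The list xs makes every eigenvalue nonzero, the copies of X0 make that of X0 large. *)
    let ?L = "replicate k X0 @ xs"
    have cnt: "count_list ?L X0 \<ge> k" by (induction k) auto
    have L: "set ?L \<subseteq> ideal_gens" using X0(1) by (simp add: xs set_replicate_conv_if)
    have "\<exists>N M. matrix_rep N M \<and> weight N M ideal_gens (\<lambda>X. of_nat (count_list ?L X) * c X)"
      using c(2) L by (rule exists_count_weight)
    then obtain N M where M: "matrix_rep N M" "weight N M ideal_gens (\<lambda>X. of_nat (count_list ?L X) * c X)"
      by blast
    obtain V v where V: "invariant_subspace N M V" "v \<in> V" "v \<noteq> 0"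
      "\<And>X. X \<in> ideal_gens \<Longrightarrow> mat_apply N (M X) v = cscale (of_nat (count_list ?L X) * c X) v"
      "\<And>W. invariant_subspace N M W \<Longrightarrow> W \<subseteq> V \<Longrightarrow> W = {0} \<or> W = V"
      by (rule exists_irreducible_weight_subspace[OF M(1) ideal_gens_u M(2)]) (rule that)
    have nz: "of_nat (count_list ?L X) * c X \<noteq> 0" if "X \<in> ideal_gens" for X
    proof -
      have "X \<in> set ?L" using that xs by simp
      then have "count_list ?L X \<noteq> 0" using count_list_0_iff by metis
      then show ?thesis using c(1)[OF that] by (metis mult_eq_0_iff of_nat_eq_0_iff)
    qed
    have irr: "irreducible_rep u br (V, complexified N M)"
      by (rule irreducible_complexified[OF M(1) V(1-3) V(5) agree])
    have "admits_negative_ricci (semidirect_carrier u V)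
        (semidirect_bracket br' (restrict_rep (complexified N M)))"
      using V(2,3) faithful_of_nonzero_weight[OF M(1) V(1-4) nz]
      by (intro admits_negative_ricci_faithful[OF M(1) V(1)]) auto
    then have adm: "admits_negative_ricci (semidirect_carrier u V)
        (semidirect_bracket br (restrict_rep (complexified N M)))"
      by (rule admits_negative_ricci_cong)
        (auto simp: semidirect_carrier_def semidirect_bracket_def agree)
    have "V \<subseteq> supported N" using V(1) by (simp add: invariant_subspace_def)
    then have "bdd_above (norm ` eigenvalues ?A (V, complexified N M))"
      by (intro bdd_aboveI[of _ "\<Sum>i\<in>N. \<Sum>j\<in>N. norm (M X0 i j)"])
        (auto simp: eigenvalues_def complexified_real[OF M(1)]
          intro!: mat_apply_eigenvalue_bound[OF matrix_repD(1)[OF M(1)]])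
    moreover have "of_nat (count_list ?L X0) * c X0 \<in> eigenvalues ?A (V, complexified N M)"
      using V(2,3) V(4)[OF X0(1)] by (auto simp: eigenvalues_def complexified_real[OF M(1)])
    ultimately have "norm (of_nat (count_list ?L X0) * c X0) \<le> ?s (V, complexified N M)"
      by (intro cSup_upper) auto
    moreover have "real k * norm (c X0) \<le> norm (of_nat (count_list ?L X0) * c X0)"
      unfolding norm_mult norm_of_nat using cnt
      by (intro mult_right_mono) (simp_all only: of_nat_le_iff norm_ge_zero)
    ultimately show ?thesis using irr adm by (intro exI[of _ "(V, complexified N M)"]) auto
  qed
  then obtain f where f: "\<And>k. ?good (f k)" "\<And>k. real k * norm (c X0) \<le> ?s (f k)" by metis
  have inf: "infinite (range (\<lambda>k. ?s (f k)))"
  proof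
    assume "finite (range (\<lambda>k. ?s (f k)))"
    then obtain b where b: "\<And>k. ?s (f k) \<le> b" by (meson Max_ge rangeI)
    obtain k where "b < real k * norm (c X0)"
      using reals_Archimedean3[of "norm (c X0)"] c(1)[OF X0(1)] by auto
    then show False using b[of k] f(2)[of k] by simp
  qed
  (* K selects one index for each spectral radius, so distinct chosen representations differ in it. *)
  obtain K where K: "inj_on (\<lambda>k. ?s (f k)) K" "range (\<lambda>k. ?s (f k)) = (\<lambda>k. ?s (f k)) ` K"
    using subset_image_inj[of "range (\<lambda>k. ?s (f k))" "\<lambda>k. ?s (f k)" UNIV] by auto
  show ?thesis
  proof (intro exI[of _ "f ` K"] conjI)
    show "infinite (f ` K)"
    proof
      assume "finite (f ` K)"
      then have "finite (?s ` f ` K)" by (rule finite_imageI)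
      then show False using inf K(2) by (simp add: image_image)
    qed
    show "pairwise (\<lambda>r r'. \<not> equivalent_rep u r r') (f ` K)"
    proof (rule pairwiseI)
      fix r r' assume r: "r \<in> f ` K" "r' \<in> f ` K" "r \<noteq> r'"
      then obtain k k' where k: "k \<in> K" "k' \<in> K" "r = f k" "r' = f k'" "k \<noteq> k'" by blast
      then have "?s r \<noteq> ?s r'" using K(1) by (auto simp: inj_on_def)
      moreover have "is_representation u br r"
        using f(1)[of k] k(3) by (cases r) (auto simp: irreducible_rep_def)
      ultimately show "\<not> equivalent_rep u r r'"
        using equivalent_rep_eigenvalues[OF _ _ A] by metis
    qed
    show "\<forall>(V, \<pi>)\<in>f ` K. irreducible_rep u br (V, \<pi>) \<and>
       admits_negative_ricci (semidirect_carrier u V) (semidirect_bracket br (restrict_rep \<pi>))"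
      using f(1) by (auto split: prod.splits) (metis fst_conv snd_conv)+
  qed
qed

end
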